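(* Let $n,m\ge1$ and let $w\in a^{\le n}(ba^n)^*b\cup\{\epsilon\}$ be such that $wa^nba^m$ is a good word. Then (1) $\vdash^*_{\{wa^n,\,wa^nb\}}$ is a well quasi-order on $L^{\epsilon}_{\vdash_{\{wa^n,\,wa^nb\}}}$, and (2) $\vdash^*_{\{wa^nb,\,wa^nba^m\}}$ is a well quasi-order on $L^{\epsilon}_{\vdash_{\{wa^nb,\,wa^nba^m\}}}$.
   Context: For a set $X$ of words, $X^{\le n}=\bigcup_{i=0}^nX^i$. For words $u,v$, the shuffle $u \sqcup\!\sqcup v$ is the set of all words $u_1v_1\cdots u_kv_k$ with $k\ge 1$, $u=u_1\cdots u_k$, $v=v_1\cdots v_k$ (pieces possibly empty). For a finite set $I$ of words, $v \vdash_I w$ means $w \in v \sqcup\!\sqcup u$ for some $u\in I$; $\vdash_I^*$ is its reflexive-transitive closure and $L^{\epsilon}_{\vdash_I}=\{w : \epsilon \vdash_I^* w\}$. A quasi-order $\le$ on $S$ is a well quasi-order iff every infinite sequence in $S$ has $i<j$ with $s_i\le s_j$. Let $E$ exchange $a$ and $b$ and $\tilde w$ be the reversal of $w$; $w$ is bad if one of $w,\tilde w,E(w),E(\tilde w)$ has a factor $a^kb^h$ ($k,h\ge2$) or $a^kba^lb^{m'}$ ($k>l\ge1$, $m'\ge1$), and good otherwise. *)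

theory Defs
  imports Main "HOL-Library.Sublist"
begin

datatype letter = a | b

type_synonym word = "letter list"

definition ins_step :: "word set \<Rightarrow> word \<Rightarrow> word \<Rightarrow> bool" where
  "ins_step I v w \<longleftrightarrow> (\<exists>u\<in>I. w \<in> shuffles v u)"

definition ins_star :: "word set \<Rightarrow> word \<Rightarrow> word \<Rightarrow> bool" where
  "ins_star I = (ins_step I)\<^sup>*\<^sup>*"

definition L_eps :: "word set \<Rightarrow> word set" where
  "L_eps I = {w. ins_star I [] w}"

definition wqo_on :: "('x \<Rightarrow> 'x \<Rightarrow> bool) \<Rightarrow> 'x set \<Rightarrow> bool" where
  "wqo_on R S \<longleftrightarrow> (\<forall>x y z. x \<in> S \<longrightarrow> y \<in> S \<longrightarrow> z \<in> S \<longrightarrow> R x x \<and> (R x y \<longrightarrow> R y z \<longrightarrow> R x z))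
     \<and> (\<forall>f :: nat \<Rightarrow> 'x. (\<forall>i. f i \<in> S) \<longrightarrow> (\<exists>i j. i < j \<and> R (f i) (f j)))"

fun exch :: "letter \<Rightarrow> letter" where
  "exch a = b" | "exch b = a"

definition E :: "word \<Rightarrow> word" where
  "E w = map exch w"

definition has_bad_factor :: "word \<Rightarrow> bool" where
  "has_bad_factor x \<longleftrightarrow>
     (\<exists>k h. k \<ge> 2 \<and> h \<ge> 2 \<and> sublist (replicate k a @ replicate h b) x) \<or>
     (\<exists>k l m'. k > l \<and> l \<ge> 1 \<and> m' \<ge> 1 \<and>
        sublist (replicate k a @ [b] @ replicate l a @ replicate m' b) x)"

definition bad :: "word \<Rightarrow> bool" where
  "bad w \<longleftrightarrow> has_bad_factor w \<or> has_bad_factor (rev w) \<or> has_bad_factor (E w) \<or> has_bad_factor (E (rev w))"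

definition good :: "word \<Rightarrow> bool" where
  "good w \<longleftrightarrow> \<not> bad w"

definition Wlang :: "nat \<Rightarrow> word set" where
  "Wlang n = {[]} \<union> {replicate i a @ concat (replicate j (b # replicate n a)) @ [b] | i j. i \<le> n}"

end

theory Submission
  imports Defs "HOL-Library.Ramsey"
begin

text \<open>
  Put \<open>stem = a\<^sup>c (b a\<^sup>n)\<^sup>J\<close>, so that both sets consist of two of the words \<open>stem\<close>, \<open>stem b\<close>, \<open>stem b a\<^sup>m\<close>.
  Serving \<open>N\<close> copies of these words in turn shows that a word is a shuffle of them iff its letter counts
  are right and its walk (number \<open>x\<close> of \<open>b\<close>, number \<open>y\<close> of \<open>a\<close> in each prefix) stays between a lower and
  an upper piecewise linear bound that scale with \<open>N\<close>. Hence \<open>v \<turnstile>\<^sup>* v'\<close> follows once \<open>v\<close> embeds in \<open>v'\<close>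
  such that the remainder has a walk between the bounds for \<open>N' - N\<close>.

  The distance between the two bounds is at least \<open>N\<close> (except where the lower one is vacuous), whereas a word has length \<open>O(N)\<close>. So every word can
  be cut into a fixed number of factors along each of which only one of the bounds comes closer than about
  \<open>N / 4\<close>; for \<open>N'\<close> much larger than \<open>N\<close> the other bound cannot be violated by the remainder. Cutting each
  factor once more where its distance to the critical bound is minimal, it remains to embed walks that never
  drop below their starting height (or their reversals) with a remainder of the same kind. Such walks form
  the closure of a finite set of words under insertion, and a minimal bad sequence argument applies.
\<close>

section \<open>Almost full relations\<close>

text \<open>The obstacle is that a minimal bad sequence argument needs a class of remainders closed
  under shuffle. For fixed N, walks confined between two bounds are not such a class, whereas walks
  that never fall below their starting height are; this forces the pieces with a single active
  bound. All constraints are homogeneous in (N, x, y). Hence the slack of a remainder is the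
  difference of the slacks of the two words at matching positions, and the bounds it has to meet are
  those for N' - N. If N stays bounded along a sequence, lengths are bounded too and some word
  repeats, so only the case of large N' needs an embedding. Goodness enters through one inequality:
  for nonempty \<open>w\<close> it gives m <= n, which makes the upper bound concave, an
  intersection of two half planes. For empty \<open>w\<close> one has J = 0 and c = n, and the upper
  bound has the single slope m, which may exceed n. The numbers of copies of the three kinds are
  tracked as well, because the remainder must be built from the two words at hand.\<close>

definition almost_full :: "('x \<Rightarrow> 'x \<Rightarrow> bool) \<Rightarrow> 'x set \<Rightarrow> bool" where
  "almost_full R S \<longleftrightarrow> (\<forall>f :: nat \<Rightarrow> 'x. (\<forall>i. f i \<in> S) \<longrightarrow> (\<exists>i j. i < j \<and> R (f i) (f j)))"

lemma almost_fullI: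
  "(\<And>f :: nat \<Rightarrow> 'x. (\<And>i. f i \<in> S) \<Longrightarrow> \<exists>i j. i < j \<and> R (f i) (f j)) \<Longrightarrow> almost_full R S"
  by (auto simp: almost_full_def)

lemma almost_fullD:
  assumes "almost_full R S" "\<And>i :: nat. f i \<in> S"
  obtains i j where "i < j" "R (f i) (f j)"
  using assms unfolding almost_full_def by blast

lemma almost_full_mono:
  assumes "almost_full R S" "T \<subseteq> S" "\<And>x y. x \<in> T \<Longrightarrow> y \<in> T \<Longrightarrow> R x y \<Longrightarrow> Q x y"
  shows "almost_full Q T"
proof (rule almost_fullI)
  fix f :: "nat \<Rightarrow> 'a" assume f: "\<And>i. f i \<in> T"
  obtain i j where "i < j" "R (f i) (f j)"
    using almost_fullD[OF assms(1), of f] f assms(2) by blast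
  thus "\<exists>i j. i < j \<and> Q (f i) (f j)" using assms(3) f by blast
qed

lemma almost_full_vimage:
  assumes "almost_full R S" "\<And>x. x \<in> T \<Longrightarrow> g x \<in> S"
  shows "almost_full (\<lambda>x y. R (g x) (g y)) T"
proof (rule almost_fullI)
  fix f :: "nat \<Rightarrow> 'b" assume f: "\<And>i. f i \<in> T"
  obtain i j where "i < j" "R (g (f i)) (g (f j))"
    using almost_fullD[OF assms(1), of "g \<circ> f"] f assms(2) by auto
  thus "\<exists>i j. i < j \<and> R (g (f i)) (g (f j))" by blast
qed

text \<open>Ramsey's theorem for pairs, coloured by whether \<open>R\<close> holds from the smaller
  to the larger index. A homogeneous set of the negative colour would be a bad sequence. No
  transitivity is involved, so conjunctions of arbitrary almost full relations become
  available.\<close>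

lemma almost_full_subsequence:
  fixes f :: "nat \<Rightarrow> 'x"
  assumes "almost_full R S" and f: "\<And>i. f i \<in> S"
  obtains \<phi> :: "nat \<Rightarrow> nat" where "strict_mono \<phi>" "\<And>i j. i < j \<Longrightarrow> R (f (\<phi> i)) (f (\<phi> j))"
proof -
  define c :: "nat set \<Rightarrow> nat" where "c X = (if R (f (Min X)) (f (Max X)) then 0 else 1)" for X
  have "\<exists>Y t. Y \<subseteq> UNIV \<and> infinite Y \<and> t < 2 \<and> (\<forall>x\<in>Y. \<forall>y\<in>Y. x \<noteq> y \<longrightarrow> c {x, y} = t)"
    by (rule Ramsey2) (auto simp: c_def)
  then obtain Y t where Y: "infinite Y" and t: "\<And>x y. x \<in> Y \<Longrightarrow> y \<in> Y \<Longrightarrow> x \<noteq> y \<Longrightarrow> c {x, y} = t"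
    by auto
  define \<phi> where "\<phi> = enumerate Y"
  have mono: "strict_mono \<phi>" using Y by (simp add: \<phi>_def strict_mono_enumerate)
  have inY: "\<phi> i \<in> Y" for i using Y by (simp add: \<phi>_def enumerate_in_set)
  have col: "c {\<phi> i, \<phi> j} = t \<and> Min {\<phi> i, \<phi> j} = \<phi> i \<and> Max {\<phi> i, \<phi> j} = \<phi> j" if "i < j" for i j
  proof -
    have "\<phi> i < \<phi> j" using mono that by (simp add: strict_mono_def)
    thus ?thesis using t[OF inY inY, of i j] by auto
  qed
  obtain i j where ij: "i < j" "R (f (\<phi> i)) (f (\<phi> j))"
    using almost_fullD[OF assms(1), of "f \<circ> \<phi>"] f by auto
  hence "t = 0" using col[OF ij(1)] by (auto simp: c_def)
  hence "R (f (\<phi> i)) (f (\<phi> j))" if "i < j" for i j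
    using col[OF that] by (auto simp: c_def split: if_splits)
  with mono that show thesis by blast
qed

lemma almost_full_conj:
  assumes "almost_full R S" "almost_full Q S"
  shows "almost_full (\<lambda>x y. R x y \<and> Q x y) S"
proof (rule almost_fullI)
  fix f :: "nat \<Rightarrow> 'a" assume f: "\<And>i. f i \<in> S"
  obtain \<phi> :: "nat \<Rightarrow> nat" where \<phi>: "strict_mono \<phi>" "\<And>i j. i < j \<Longrightarrow> R (f (\<phi> i)) (f (\<phi> j))"
    using almost_full_subsequence[OF assms(1), of f] f by blast
  obtain i j where "i < j" "Q (f (\<phi> i)) (f (\<phi> j))"
    using almost_fullD[OF assms(2), of "f \<circ> \<phi>"] f by auto
  thus "\<exists>i j. i < j \<and> R (f i) (f j) \<and> Q (f i) (f j)"
    using \<phi> by (meson strict_mono_less)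
qed

lemma almost_full_eq_finite:
  assumes "finite S"
  shows "almost_full (=) S"
proof (rule almost_fullI)
  fix f :: "nat \<Rightarrow> 'a" assume "\<And>i. f i \<in> S"
  hence "finite (range f)" using assms by (auto intro: finite_subset)
  hence "\<not> inj f" using finite_imageD infinite_UNIV_nat by blast
  then obtain i j where "i \<noteq> j" "f i = f j" by (auto simp: inj_on_def)
  thus "\<exists>i j. i < j \<and> f i = f j" by (metis nat_neq_iff)
qed

lemma almost_full_nat: "almost_full (\<le>) (UNIV :: nat set)"
proof (rule almost_fullI)
  fix f :: "nat \<Rightarrow> nat"
  obtain k where "\<And>i. f k \<le> f i" using arg_min_nat_lemma[of "\<lambda>_. True" 0 f] by blast
  thus "\<exists>i j. i < j \<and> f i \<le> f j" by blast
qed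

lemma almost_full_Un:
  assumes "almost_full R S" "almost_full R T"
  shows "almost_full R (S \<union> T)"
proof (rule almost_fullI)
  fix f :: "nat \<Rightarrow> 'a" assume f: "\<And>i. f i \<in> S \<union> T"
  have "almost_full (=) (UNIV :: bool set)" by (rule almost_full_eq_finite) simp
  then obtain \<phi> :: "nat \<Rightarrow> nat" where \<phi>: "strict_mono \<phi>"
    "\<And>i j. i < j \<Longrightarrow> (f (\<phi> i) \<in> S) = (f (\<phi> j) \<in> S)"
    using almost_full_subsequence[of "(=)" UNIV "\<lambda>i. f i \<in> S"] by auto
  have "(\<forall>i. f (\<phi> i) \<in> S) \<or> (\<forall>i. f (\<phi> i) \<in> T)"
    using \<phi>(2) f by (metis UnE neq_iff)
  then obtain i j where "i < j" "R (f (\<phi> i)) (f (\<phi> j))"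
    using almost_fullD[OF assms(1), of "f \<circ> \<phi>"] almost_fullD[OF assms(2), of "f \<circ> \<phi>"]
    by (metis comp_apply)
  thus "\<exists>i j. i < j \<and> R (f i) (f j)" using \<phi>(1) by (meson strict_mono_less)
qed

text \<open>Dickson's lemma for tuples. The length is fixed, which is why words are later cut into a
  number of pieces independent of the word.\<close>

lemma almost_full_lists:
  assumes "almost_full R S"
  shows "almost_full (list_all2 R) {xs. length xs = k \<and> set xs \<subseteq> S}"
proof (induction k)
  case 0
  show ?case by (rule almost_fullI) auto
next
  case (Suc k)
  let ?T = "{xs. length xs = Suc k \<and> set xs \<subseteq> S}"
  have "almost_full (\<lambda>xs ys. R (hd xs) (hd ys)) ?T"
    by (rule almost_full_vimage[OF assms]) (auto simp: length_Suc_conv)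
  moreover have "almost_full (\<lambda>xs ys. list_all2 R (tl xs) (tl ys)) ?T"
    by (rule almost_full_vimage[OF Suc.IH]) (auto simp: length_Suc_conv)
  ultimately have "almost_full (\<lambda>xs ys. R (hd xs) (hd ys) \<and> list_all2 R (tl xs) (tl ys)) ?T"
    by (rule almost_full_conj)
  thus ?case by (rule almost_full_mono) (auto simp: length_Suc_conv)
qed

text \<open>The choice of Nash-Williams, made for whole sequences: \<open>F k\<close> is a bad
  sequence whose entries below \<open>k\<close> are final, and \<open>step k\<close> replaces it by
  one that agrees there and has a shortest possible entry at \<open>k\<close>. The result
  \<open>g\<close> is the diagonal.\<close>

lemma minimal_bad_sequence:
  assumes bad: "\<not> almost_full R S"
  obtains g :: "nat \<Rightarrow> 'x list" where
    "\<forall>i. g i \<in> S" "\<forall>i j. i < j \<longrightarrow> \<not> R (g i) (g j)"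
    "\<forall>k h. (\<forall>i. h i \<in> S) \<longrightarrow> (\<forall>i j. i < j \<longrightarrow> \<not> R (h i) (h j)) \<longrightarrow>
        (\<forall>i<k. h i = g i) \<longrightarrow> length (g k) \<le> length (h k)"
proof -
  define B where "B = {f :: nat \<Rightarrow> 'x list. (\<forall>i. f i \<in> S) \<and> (\<forall>i j. i < j \<longrightarrow> \<not> R (f i) (f j))}"
  obtain f0 where f0: "f0 \<in> B" using bad by (auto simp: almost_full_def B_def)
  define step where "step k f = (ARG_MIN (\<lambda>h. length (h k)) h. h \<in> B \<and> (\<forall>i<k. h i = f i))" for k f
  define F where "F = rec_nat f0 step"
  have F0: "F 0 = f0" and FS: "F (Suc k) = step k (F k)" for k by (simp_all add: F_def)
  have step: "step k f \<in> B \<and> (\<forall>i<k. step k f i = f i) \<and>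
      (\<forall>h. h \<in> B \<and> (\<forall>i<k. h i = f i) \<longrightarrow> length (step k f k) \<le> length (h k))" if "f \<in> B" for k f
    using arg_min_nat_lemma[of "\<lambda>h. h \<in> B \<and> (\<forall>i<k. h i = f i)" f "\<lambda>h. length (h k)"] that
    unfolding step_def by blast
  have FB: "F k \<in> B" for k by (induction k) (auto simp: F0 FS f0 step)
  have stable: "F (k + d) i = F k i" if "i < k" for k d i
    using that by (induction d) (auto simp: FS step FB)
  define g where "g k = F (Suc k) k" for k
  have Fg: "F k i = g i" if "i < k" for i k
    using stable[of i "Suc i" "k - Suc i"] that by (simp add: g_def)
  show thesis
  proof
    show "\<forall>i. g i \<in> S" using FB by (auto simp: B_def g_def)
    have "\<not> R (g i) (g j)" if "i < j" for i j
    proof -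
      have "\<not> R (F (Suc j) i) (F (Suc j) j)" using FB[of "Suc j"] that by (simp add: B_def)
      thus ?thesis using Fg[of i "Suc j"] Fg[of j "Suc j"] that by simp
    qed
    thus "\<forall>i j. i < j \<longrightarrow> \<not> R (g i) (g j)" by blast
    have "length (g k) \<le> length (h k)" if "h \<in> B" "\<forall>i<k. h i = g i" for k h
    proof -
      have "\<forall>i<k. h i = F k i" using that Fg[of _ k] by simp
      thus ?thesis using step[OF FB[of k], of k] that(1) unfolding g_def FS by blast
    qed
    thus "\<forall>k h. (\<forall>i. h i \<in> S) \<longrightarrow> (\<forall>i j. i < j \<longrightarrow> \<not> R (h i) (h j)) \<longrightarrow>
        (\<forall>i<k. h i = g i) \<longrightarrow> length (g k) \<le> length (h k)"
      by (simp add: B_def)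
  qed
qed

section \<open>Shuffles\<close>

lemma shuffles_append:
  "xs' \<in> shuffles xs us \<Longrightarrow> ys' \<in> shuffles ys vs \<Longrightarrow> xs' @ ys' \<in> shuffles (xs @ ys) (us @ vs)"
proof (induction xs' arbitrary: xs us)
  case (Cons x xs')
  from Cons.prems(1) consider
      (left) zs where "xs = x # zs" "xs' \<in> shuffles zs us"
    | (right) zs where "us = x # zs" "xs' \<in> shuffles xs zs"
    by (auto elim: shufflesE)
  thus ?case
    using Cons.IH Cons.prems(2)
    by cases (auto intro: Cons_in_shuffles_leftI Cons_in_shuffles_rightI)
qed auto

lemma shuffles_Nil_right [simp]: "xs \<in> shuffles ys [] \<longleftrightarrow> xs = ys" by (cases ys) simp_all

lemma shuffles_rev: "zs \<in> shuffles xs ys \<Longrightarrow> rev zs \<in> shuffles (rev xs) (rev ys)"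
proof (induction zs arbitrary: xs ys)
  case (Cons z zs)
  from Cons.prems consider
      (left) us where "xs = z # us" "zs \<in> shuffles us ys"
    | (right) us where "ys = z # us" "zs \<in> shuffles xs us"
    by (auto elim: shufflesE)
  thus ?case
  proof cases
    case left
    show ?thesis using shuffles_append[OF Cons.IH[OF left(2)], of "[z]" "[z]" "[]"] left by simp
  next
    case right
    show ?thesis using shuffles_append[OF Cons.IH[OF right(2)], of "[z]" "[]" "[z]"] right by simp
  qed
qed auto

lemma shuffles_map: "zs \<in> shuffles xs ys \<Longrightarrow> map f zs \<in> shuffles (map f xs) (map f ys)"
proof (induction zs arbitrary: xs ys)
  case (Cons z zs)
  thus ?case
    by (fastforce simp: Cons_in_shuffles_iff neq_Nil_conv
        intro: Cons_in_shuffles_leftI Cons_in_shuffles_rightI)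
qed auto

lemma shuffles_assoc:
  assumes "ws \<in> shuffles us zs" "us \<in> shuffles xs ys"
  shows "\<exists>vs. ws \<in> shuffles xs vs \<and> vs \<in> shuffles ys zs"
  using assms
proof (induction ws arbitrary: us xs ys zs)
  case (Cons w ws)
  from Cons.prems(1) consider
      (left) us' where "us = w # us'" "ws \<in> shuffles us' zs"
    | (right) zs' where "zs = w # zs'" "ws \<in> shuffles us zs'"
    by (auto elim: shufflesE)
  thus ?case
  proof cases
    case left
    from Cons.prems(2) left(1) consider
        (l) xs' where "xs = w # xs'" "us' \<in> shuffles xs' ys"
      | (r) ys' where "ys = w # ys'" "us' \<in> shuffles xs ys'"
      by (auto elim: shufflesE)
    thus ?thesis
      using Cons.IH[OF left(2)]
      by cases (blast intro: Cons_in_shuffles_leftI Cons_in_shuffles_rightI)+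
  next
    case right
    thus ?thesis
      using Cons.IH[OF right(2) Cons.prems(2)]
      by (blast intro: Cons_in_shuffles_leftI Cons_in_shuffles_rightI)
  qed
qed auto

lemma shuffles_assoc':
  assumes "ws \<in> shuffles xs vs" "vs \<in> shuffles ys zs"
  shows "\<exists>us. ws \<in> shuffles us zs \<and> us \<in> shuffles xs ys"
  using shuffles_assoc[of ws vs xs zs ys] assms by (metis shuffles_commutes)

lemma shuffles_prefix:
  "ws \<in> shuffles us vs \<Longrightarrow> prefix p ws \<Longrightarrow>
    \<exists>q r. prefix q us \<and> prefix r vs \<and> p \<in> shuffles q r"
proof (induction p arbitrary: ws us vs)
  case (Cons x p)
  then obtain ws' where ws: "ws = x # ws'" "prefix p ws'" by (cases ws) auto
  with Cons.prems(1) consider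
      (left) zs where "us = x # zs" "ws' \<in> shuffles zs vs"
    | (right) zs where "vs = x # zs" "ws' \<in> shuffles us zs"
    by (auto elim: shufflesE)
  thus ?case
  proof cases
    case left
    obtain q r where "prefix q zs" "prefix r vs" "p \<in> shuffles q r"
      using Cons.IH[OF left(2) ws(2)] by blast
    thus ?thesis using left Cons_in_shuffles_leftI[of p q r x] by (intro exI[of _ "x # q"] exI[of _ r]) auto
  next
    case right
    obtain q r where "prefix q us" "prefix r zs" "p \<in> shuffles q r"
      using Cons.IH[OF right(2) ws(2)] by blast
    thus ?thesis using right Cons_in_shuffles_rightI[of p q r x] by (intro exI[of _ q] exI[of _ "x # r"]) auto
  qed
qed (intro exI[of _ "[]"], auto)

text \<open>Here a prefix of one factor is prescribed, not one of the shuffle: it locates a position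
  of the remainder in the longer word and in the shorter word at once.\<close>

lemma shuffles_prefix_right:
  "ws \<in> shuffles us vs \<Longrightarrow> prefix r vs \<Longrightarrow>
    \<exists>p q. prefix p ws \<and> prefix q us \<and> p \<in> shuffles q r"
proof (induction ws arbitrary: us vs r)
  case (Cons x ws)
  show ?case
  proof (cases "r = []")
    case True
    thus ?thesis by (intro exI[of _ "[]"]) auto
  next
    case False
    from Cons.prems(1) consider
        (left) zs where "us = x # zs" "ws \<in> shuffles zs vs"
      | (right) zs where "vs = x # zs" "ws \<in> shuffles us zs"
      by (auto elim: shufflesE)
    thus ?thesis
    proof cases
      case left
      obtain p q where "prefix p ws" "prefix q zs" "p \<in> shuffles q r"
        using Cons.IH[OF left(2) Cons.prems(2)] by blast
      thus ?thesis using left Cons_in_shuffles_leftI[of p q r x]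
        by (intro exI[of _ "x # p"] exI[of _ "x # q"]) auto
    next
      case right
      then obtain r' where r': "r = x # r'" "prefix r' zs"
        using False Cons.prems(2) by (cases r) auto
      obtain p q where "prefix p ws" "prefix q us" "p \<in> shuffles q r'"
        using Cons.IH[OF right(2) r'(2)] by blast
      thus ?thesis using r' Cons_in_shuffles_rightI[of p q r' x]
        by (intro exI[of _ "x # p"] exI[of _ q]) auto
    qed
  qed
qed auto

lemma count_list_shuffles:
  "zs \<in> shuffles xs ys \<Longrightarrow> count_list zs l = count_list xs l + count_list ys l"
proof (induction zs arbitrary: xs ys)
  case (Cons z zs)
  thus ?case by (fastforce simp: Cons_in_shuffles_iff neq_Nil_conv)
qed auto

section \<open>Closure under insertion\<close>

definition weave :: "'x list \<Rightarrow> 'x list list \<Rightarrow> 'x list" where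
  "weave f xs = concat (map2 (#) f xs)"

lemma weave_simps [simp]: "weave [] xs = []" "weave (l # f) (x # xs) = l # x @ weave f xs"
  by (simp_all add: weave_def)

lemma append_in_shuffles: "xs @ ys \<in> shuffles xs ys"
  using shuffles_append[of xs xs "[]" ys "[]" ys] by simp

lemma weave_in_shuffles: "length xs = length f \<Longrightarrow> weave f xs \<in> shuffles f (concat xs)"
proof (induction f arbitrary: xs)
  case (Cons l f)
  then obtain x ys where xs: "xs = x # ys" by (cases xs) auto
  have "weave f ys \<in> shuffles f (concat ys)" using Cons xs by simp
  from shuffles_append[OF _ this, of x "[]" x]
  have "x @ weave f ys \<in> shuffles f (x @ concat ys)" by simp
  thus ?case using xs by (simp add: Cons_in_shuffles_leftI)
qed simp

text \<open>Since \<open>weave\<close> puts a slot after every letter of \<open>g\<close> and none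
  before the first, every cut except the one at the very beginning falls into exactly one
  slot.\<close>

lemma weave_split:
  assumes "length xs = length g" "weave g xs = p @ q" "p \<noteq> []"
  shows "\<exists>ys y y' zs. xs = ys @ (y @ y') # zs \<and> (\<forall>t. p @ t @ q = weave g (ys @ (y @ t @ y') # zs))"
  using assms
proof (induction g arbitrary: xs p)
  case (Cons l g)
  then obtain x xs' where xs: "xs = x # xs'" by (cases xs) auto
  from Cons.prems xs obtain p' where p: "p = l # p'" by (cases p) auto
  have eq: "x @ weave g xs' = p' @ q" using Cons.prems xs p by simp
  then consider (inside) s where "x = p' @ s" "q = s @ weave g xs'"
    | (after) p'' where "p' = x @ p''" "weave g xs' = p'' @ q" "p'' \<noteq> []"
  proof -
    obtain us where us: "x = p' @ us \<and> us @ weave g xs' = q \<or> x @ us = p' \<and> weave g xs' = us @ q"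
      using eq by (auto simp: append_eq_append_conv2)
    show thesis using us inside[of us] inside[of "[]"] after[of us] by (cases "us = []") auto
  qed
  thus ?case
  proof cases
    case inside
    thus ?thesis using xs p by (intro exI[of _ "[]"] exI[of _ p'] exI[of _ s] exI[of _ xs']) simp
  next
    case after
    obtain ys y y' zs where IH: "xs' = ys @ (y @ y') # zs"
      "\<And>t. p'' @ t @ q = weave g (ys @ (y @ t @ y') # zs)"
      using Cons.IH[OF _ after(2,3)] Cons.prems xs by auto
    thus ?thesis using xs p after
      by (intro exI[of _ "x # ys"] exI[of _ y] exI[of _ y'] exI[of _ zs]) simp
  qed
qed simp

text \<open>Generated by root decompositions instead of single insertions, so that each nonempty
  member carries a tree structure: a root from \<open>F\<close> whose slots hold smaller members.
  Closure under single insertions is then a lemma.\<close>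

inductive_set insertion_closure :: "'x list set \<Rightarrow> 'x list set" for F where
  Nil: "[] \<in> insertion_closure F"
| weave: "f \<in> F \<Longrightarrow> length xs = length f \<Longrightarrow> (\<And>x. x \<in> set xs \<Longrightarrow> x \<in> insertion_closure F) \<Longrightarrow>
    weave f xs \<in> insertion_closure F"

lemma weave_last:
  assumes "f \<noteq> []"
  shows "weave f (replicate (length f - 1) [] @ [v]) = f @ v"
proof -
  have "weave (g @ [l]) (replicate (length g) [] @ [v]) = g @ l # v" for g :: "'a list" and l
    by (induction g) simp_all
  from this[of "butlast f" "last f"] show ?thesis using assms
    by (metis append.assoc append_Cons append_Nil append_butlast_last_id length_butlast)
qed

text \<open>There is no slot in front of a root, so \<open>f\<close> becomes the new root and keeps
  \<open>v\<close> in its last slot.\<close>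

lemma insertion_closure_prepend:
  assumes "v \<in> insertion_closure F" "f \<in> F" "f \<noteq> []"
  shows "f @ v \<in> insertion_closure F"
proof -
  have "weave f (replicate (length f - 1) [] @ [v]) \<in> insertion_closure F"
    using assms by (intro insertion_closure.weave) (auto intro: insertion_closure.Nil)
  thus ?thesis using weave_last[OF assms(3)] by metis
qed

lemma insertion_closure_insert:
  assumes "v \<in> insertion_closure F" "v = p @ q" "f \<in> F" "f \<noteq> []"
  shows "p @ f @ q \<in> insertion_closure F"
  using assms(1,2)
proof (induction arbitrary: p q rule: insertion_closure.induct)
  case Nil
  thus ?case using insertion_closure_prepend[OF insertion_closure.Nil assms(3,4)] by simp
next
  case (weave g xs)
  show ?case
  proof (cases "p = []")
    case True
    have "weave g xs \<in> insertion_closure F" using weave by (intro insertion_closure.weave)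
    thus ?thesis using True weave.prems insertion_closure_prepend assms(3,4) by auto
  next
    case False
    obtain ys y y' zs where split: "xs = ys @ (y @ y') # zs"
      "\<And>t. p @ t @ q = weave g (ys @ (y @ t @ y') # zs)"
      using weave_split[OF weave.hyps(2) weave.prems False] by blast
    have "y @ f @ y' \<in> insertion_closure F"
      using weave.IH[of "y @ y'" y y'] split by simp
    thus ?thesis unfolding split(2) using split weave.hyps
      by (intro insertion_closure.weave) auto
  qed
qed

section \<open>Orders given by remainders from a shuffle-closed class\<close>

definition shuffle_closed :: "'x list set \<Rightarrow> bool" where
  "shuffle_closed P \<longleftrightarrow> [] \<in> P \<and> (\<forall>x\<in>P. \<forall>y\<in>P. shuffles x y \<subseteq> P)"

definition shuffle_le :: "'x list set \<Rightarrow> 'x list \<Rightarrow> 'x list \<Rightarrow> bool" where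
  "shuffle_le P v w \<longleftrightarrow> (\<exists>z\<in>P. w \<in> shuffles v z)"

lemma shuffle_closed_append: "shuffle_closed P \<Longrightarrow> x \<in> P \<Longrightarrow> y \<in> P \<Longrightarrow> x @ y \<in> P"
  unfolding shuffle_closed_def using append_in_shuffles by blast

lemma shuffle_closed_concat: "shuffle_closed P \<Longrightarrow> set xs \<subseteq> P \<Longrightarrow> concat xs \<in> P"
  by (induction xs) (auto simp: shuffle_closed_append, simp add: shuffle_closed_def)

lemma shuffle_le_trans:
  assumes "shuffle_closed P" "shuffle_le P u v" "shuffle_le P v w"
  shows "shuffle_le P u w"
proof -
  obtain y z where yz: "y \<in> P" "v \<in> shuffles u y" "z \<in> P" "w \<in> shuffles v z"
    using assms by (auto simp: shuffle_le_def)
  obtain t where "w \<in> shuffles u t" "t \<in> shuffles y z"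
    using shuffles_assoc[OF yz(4,2)] by blast
  thus ?thesis using assms(1) yz unfolding shuffle_le_def shuffle_closed_def by blast
qed

text \<open>Equal roots cancel; the remainder is the concatenation of the remainders of the
  slots.\<close>

lemma shuffle_le_weave:
  assumes "shuffle_closed P" "length xs = length f" "list_all2 (shuffle_le P) xs ys"
  shows "shuffle_le P (weave f xs) (weave f ys)"
  using assms(2,3)
proof (induction f arbitrary: xs ys)
  case Nil
  thus ?case using assms(1) by (auto simp: shuffle_le_def shuffle_closed_def)
next
  case (Cons l f)
  then obtain x xs' y ys' where xs: "xs = x # xs'" "ys = y # ys'"
    by (cases xs; cases ys) auto
  with Cons.prems obtain z where z: "z \<in> P" "y \<in> shuffles x z" by (auto simp: shuffle_le_def)
  obtain t where t: "t \<in> P" "weave f ys' \<in> shuffles (weave f xs') t"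
    using Cons.IH[of xs' ys'] Cons.prems xs by (auto simp: shuffle_le_def)
  have "weave (l # f) ys \<in> shuffles (weave (l # f) xs) (z @ t)"
    using shuffles_append[OF z(2) t(2)] xs by (simp add: Cons_in_shuffles_leftI)
  thus ?case using shuffle_closed_append[OF assms(1) z(1) t(1)] by (auto simp: shuffle_le_def)
qed

text \<open>The remainder is a shuffle of the root with the other slots, and all of these lie in
  \<open>P\<close>.\<close>

lemma shuffle_le_weave_part:
  assumes P: "shuffle_closed P" and "f \<in> P" "length xs = length f" "set xs \<subseteq> P" "x \<in> set xs"
  shows "shuffle_le P x (weave f xs)"
proof -
  obtain ys zs where xs: "xs = ys @ x # zs" using assms(5) by (meson split_list)
  define r where "r = concat ys @ concat zs"
  have "concat xs \<in> shuffles x r"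
    using shuffles_append[of "concat ys" "[]" "concat ys" "x @ concat zs" x "concat zs"]
      append_in_shuffles[of x "concat zs"] by (simp add: xs r_def)
  moreover have "weave f xs \<in> shuffles (concat xs) f"
    using weave_in_shuffles[OF assms(3)] by (simp add: shuffles_commutes)
  ultimately obtain t where t: "weave f xs \<in> shuffles x t" "t \<in> shuffles r f"
    using shuffles_assoc by blast
  have "r = concat (ys @ zs)" by (simp add: r_def)
  hence "r \<in> P" using shuffle_closed_concat[OF P, of "ys @ zs"] assms(4) xs by auto
  hence "t \<in> P" using t(2) assms(2) P by (auto simp: shuffle_closed_def)
  thus ?thesis using t(1) by (auto simp: shuffle_le_def)
qed

lemma insertion_closure_subset:
  assumes P: "shuffle_closed P" and "F \<subseteq> P" "v \<in> insertion_closure F"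
  shows "v \<in> P"
  using assms(3)
proof induction
  case Nil
  thus ?case using P by (simp add: shuffle_closed_def)
next
  case (weave f xs)
  have "concat xs \<in> P" using weave.IH by (intro shuffle_closed_concat[OF P]) blast
  thus ?case using weave_in_shuffles[OF weave.hyps(2)] weave.hyps(1) assms(2) P
    unfolding shuffle_closed_def by blast
qed

text \<open>A Kruskal-style argument. Undoing deletions of factors shows that \<open>P\<close> lies
  in the insertion closure of \<open>F\<close>, so nonempty members of \<open>P\<close> are trees
  with finitely many possible roots. The slots of a minimal bad sequence form an almost full set;
  comparing slot lists under a common root then contradicts badness.\<close>

lemma almost_full_shuffle_le:
  assumes P: "shuffle_closed P" and F: "finite F" "F \<subseteq> P" "[] \<notin> F"
    and reducible: "\<And>v. v \<in> P \<Longrightarrow> v \<noteq> [] \<Longrightarrow> \<exists>p f q. v = p @ f @ q \<and> f \<in> F \<and> p @ q \<in> P"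
  shows "almost_full (shuffle_le P) P"
proof (rule ccontr)
  have closure: "v \<in> insertion_closure F" if "v \<in> P" for v
    using that
  proof (induction "length v" arbitrary: v rule: less_induct)
    case less
    show ?case
    proof (cases "v = []")
      case False
      then obtain p f q where v: "v = p @ f @ q" "f \<in> F" "p @ q \<in> P" using reducible less.prems by blast
      hence "f \<noteq> []" using F by blast
      hence "p @ q \<in> insertion_closure F" using less.hyps[of "p @ q"] v by simp
      thus ?thesis using insertion_closure_insert v \<open>f \<noteq> []\<close> by blast
    qed (simp add: insertion_closure.Nil)
  qed
  have root: "\<exists>f xs. f \<in> F \<and> length xs = length f \<and> set xs \<subseteq> P \<and> v = weave f xs" if "v \<in> P" "v \<noteq> []" for v
    using closure[OF that(1)]
  proof cases
    case Nil
    thus ?thesis using that by simp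
  next
    case (weave f xs)
    thus ?thesis using insertion_closure_subset[OF P F(2)] by blast
  qed
  assume bad: "\<not> almost_full (shuffle_le P) P"
  obtain g :: "nat \<Rightarrow> 'a list" where g': "\<forall>i. g i \<in> P" "\<forall>i j. i < j \<longrightarrow> \<not> shuffle_le P (g i) (g j)"
    and minimal: "\<forall>k h. (\<forall>i. h i \<in> P) \<longrightarrow> (\<forall>i j. i < j \<longrightarrow> \<not> shuffle_le P (h i) (h j)) \<longrightarrow>
        (\<forall>i<k. h i = g i) \<longrightarrow> length (g k) \<le> length (h k)"
    by (rule minimal_bad_sequence[OF bad])
  hence g: "\<And>i. g i \<in> P" "\<And>i j. i < j \<Longrightarrow> \<not> shuffle_le P (g i) (g j)" by blast+
  have "g i \<noteq> []" for i
  proof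
    assume "g i = []"
    hence "shuffle_le P (g i) (g (Suc i))" using g(1)[of "Suc i"] by (auto simp: shuffle_le_def)
    thus False using g(2)[of i "Suc i"] by simp
  qed
  hence "\<forall>i. \<exists>f xs. f \<in> F \<and> length xs = length f \<and> set xs \<subseteq> P \<and> g i = weave f xs"
    using root g(1) by blast
  then obtain f xs where fx: "\<And>i. f i \<in> F" "\<And>i. length (xs i) = length (f i)"
    "\<And>i. set (xs i) \<subseteq> P" "\<And>i. g i = weave (f i) (xs i)" by metis
  define T where "T = (\<Union>i. set (xs i))"
  have part: "shuffle_le P x (g i)" if "x \<in> set (xs i)" for x i
    using shuffle_le_weave_part[OF P subsetD[OF F(2) fx(1)] fx(2,3) that] fx(4) by simp
  have shorter: "length x < length (g i)" if "x \<in> set (xs i)" for x i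
  proof -
    have "length (g i) = length (f i) + length (concat (xs i))"
      using length_shuffles[OF weave_in_shuffles[OF fx(2)[of i]]] fx(4) by simp
    moreover have "f i \<noteq> []" using fx(1)[of i] F(3) by metis
    moreover have "length x \<le> length (concat (xs i))"
      using that by (auto dest!: split_list)
    ultimately show ?thesis by (cases "f i") auto
  qed
  have "almost_full (shuffle_le P) T"
  proof (rule ccontr)
    assume "\<not> almost_full (shuffle_le P) T"
    then obtain h :: "nat \<Rightarrow> 'a list" where h: "\<And>i. h i \<in> T" "\<And>i j. i < j \<Longrightarrow> \<not> shuffle_le P (h i) (h j)"
      by (auto simp: almost_full_def)
    have "\<forall>l. \<exists>k. h l \<in> set (xs k)" using h(1) by (auto simp: T_def)
    then obtain \<kappa> where \<kappa>: "\<And>l. h l \<in> set (xs (\<kappa> l))" by metis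
    obtain l0 where l0: "\<And>l. \<kappa> l0 \<le> \<kappa> l"
      using arg_min_nat_lemma[of "\<lambda>_. True" 0 \<kappa>] by blast
    \<comment> \<open>\<open>k\<close> is the least index whose word contributes a slot to
      \<open>h\<close>. Splicing \<open>h\<close> from \<open>l0\<close> on after the first
      \<open>k\<close> entries of \<open>g\<close> stays bad: a relation from \<open>g i\<close> to
      some \<open>h l\<close> would pass on to \<open>g (\<kappa> l)\<close>, and i < k <= \<kappa>
      l. The entry at \<open>k\<close> has become shorter.\<close>
    define k where "k = \<kappa> l0"
    define h' where "h' i = (if i < k then g i else h (l0 + (i - k)))" for i
    have "length (g k) \<le> length (h' k)"
    proof (rule minimal[rule_format])
      show "h' i \<in> P" for i using g(1) \<kappa> fx(3) by (auto simp: h'_def)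
      show "\<not> shuffle_le P (h' i) (h' j)" if "i < j" for i j
      proof
        assume le: "shuffle_le P (h' i) (h' j)"
        consider "j < k" | "i < k" "k \<le> j" | "k \<le> i" using that by linarith
        thus False
        proof cases
          case 1
          thus ?thesis using le g(2)[OF that] that by (simp add: h'_def)
        next
          case 2
          let ?l = "l0 + (j - k)"
          have "shuffle_le P (g i) (h ?l)" using le 2 by (simp add: h'_def)
          hence "shuffle_le P (g i) (g (\<kappa> ?l))"
            using part[OF \<kappa>[of ?l]] shuffle_le_trans[OF P] by blast
          moreover have "i < \<kappa> ?l" using 2 l0[of ?l] by (simp add: k_def)
          ultimately show ?thesis using g(2) by blast
        next
          case 3
          have "l0 + (i - k) < l0 + (j - k)" using that 3 by arith
          thus ?thesis using le h(2)[of "l0 + (i - k)" "l0 + (j - k)"] 3 that by (simp add: h'_def)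
        qed
      qed
      show "h' i = g i" if "i < k" for i using that by (simp add: h'_def)
    qed
    moreover have "length (h' k) < length (g k)"
      using shorter[OF \<kappa>[of l0]] by (simp add: h'_def k_def)
    ultimately show False by simp
  qed
  hence lists: "almost_full (list_all2 (shuffle_le P)) {ys. length ys = k \<and> set ys \<subseteq> T}" for k
    by (rule almost_full_lists)
  \<comment> \<open>Passing to a constant root gives all slot lists the same length, as the
    comparison of tuples requires.\<close>
  obtain \<phi> :: "nat \<Rightarrow> nat" where \<phi>: "strict_mono \<phi>" "\<And>i j. i < j \<Longrightarrow> f (\<phi> i) = f (\<phi> j)"
    using almost_full_subsequence[OF almost_full_eq_finite[OF F(1)], of f] fx(1) by blast
  have const: "f (\<phi> i) = f (\<phi> 0)" for i using \<phi>(2)[of 0 i] by (cases i) auto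
  obtain i j where ij: "i < j" "list_all2 (shuffle_le P) (xs (\<phi> i)) (xs (\<phi> j))"
  proof (rule almost_fullD[OF lists, of "xs \<circ> \<phi>" "length (f (\<phi> 0))"])
    show "(xs \<circ> \<phi>) i \<in> {ys. length ys = length (f (\<phi> 0)) \<and> set ys \<subseteq> T}" for i
      using fx(2) const[of i] by (auto simp: T_def)
  qed auto
  have "shuffle_le P (g (\<phi> i)) (g (\<phi> j))"
    using shuffle_le_weave[OF P fx(2) ij(2)] const fx(4) by metis
  thus False using g(2) ij(1) \<phi>(1) by (meson strict_mono_less)
qed

section \<open>Walks that stay above their starting point\<close>

abbreviation na :: "word \<Rightarrow> int" where "na w \<equiv> int (count_list w a)"
abbreviation nb :: "word \<Rightarrow> int" where "nb w \<equiv> int (count_list w b)"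

definition wt :: "int \<Rightarrow> int \<Rightarrow> word \<Rightarrow> int" where
  "wt \<alpha> \<beta> w = \<alpha> * nb w + \<beta> * na w"

definition nonneg_walks :: "int \<Rightarrow> int \<Rightarrow> word set" where
  "nonneg_walks \<alpha> \<beta> = {w. \<forall>p. prefix p w \<longrightarrow> 0 \<le> wt \<alpha> \<beta> p}"

lemma wt_simps [simp]: "wt \<alpha> \<beta> [] = 0" "wt \<alpha> \<beta> (a # w) = \<beta> + wt \<alpha> \<beta> w"
  "wt \<alpha> \<beta> (b # w) = \<alpha> + wt \<alpha> \<beta> w" "wt \<alpha> \<beta> (v @ w) = wt \<alpha> \<beta> v + wt \<alpha> \<beta> w"
  by (simp_all add: wt_def algebra_simps)

lemma wt_replicate [simp]: "wt \<alpha> \<beta> (replicate k a) = \<beta> * int k"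
  by (induction k) (simp_all add: algebra_simps)

lemma wt_shuffles: "w \<in> shuffles u v \<Longrightarrow> wt \<alpha> \<beta> w = wt \<alpha> \<beta> u + wt \<alpha> \<beta> v"
  by (simp add: wt_def count_list_shuffles algebra_simps)

lemma nonneg_walks_append:
  "v @ w \<in> nonneg_walks \<alpha> \<beta> \<longleftrightarrow>
    v \<in> nonneg_walks \<alpha> \<beta> \<and> (\<forall>p. prefix p w \<longrightarrow> 0 \<le> wt \<alpha> \<beta> v + wt \<alpha> \<beta> p)"
  by (auto simp: nonneg_walks_def prefix_append)

lemma shuffle_closed_nonneg_walks: "shuffle_closed (nonneg_walks \<alpha> \<beta>)"
  unfolding shuffle_closed_def
proof (intro conjI ballI subsetI)
  fix x y z assume "x \<in> nonneg_walks \<alpha> \<beta>" "y \<in> nonneg_walks \<alpha> \<beta>" "z \<in> shuffles x y"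
  thus "z \<in> nonneg_walks \<alpha> \<beta>"
    unfolding nonneg_walks_def using shuffles_prefix wt_shuffles by (smt (verit) mem_Collect_eq)
qed (simp add: nonneg_walks_def)

lemma prefix_replicateD:
  assumes "prefix p (replicate k x)"
  shows "\<exists>j\<le>k. p = replicate j x"
proof -
  have "p = take (length p) (replicate k x)" using assms by (metis append_eq_conv_conj prefix_def)
  hence "p = replicate (min (length p) k) x" by (simp add: take_replicate)
  thus ?thesis by (intro exI[of _ "min (length p) k"]) simp
qed

lemma no_b_replicate: "b \<notin> set w \<Longrightarrow> w = replicate (length w) a"
  by (induction w) (auto, metis letter.exhaust)

text \<open>The first \<open>b\<close> is preceded by at least l letters \<open>a\<close>, and
  nothing else. Deleting the factor a^l b of weight 0 there leaves the heights of all later prefixes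
  unchanged. Without any \<open>b\<close> a single \<open>a\<close> is deleted.\<close>

lemma almost_full_up_walks:
  assumes "l \<ge> 0"
  shows "almost_full (shuffle_le (nonneg_walks (- l) 1)) (nonneg_walks (- l) 1)"
proof (rule almost_full_shuffle_le[OF shuffle_closed_nonneg_walks])
  let ?P = "nonneg_walks (- l) 1" and ?F = "{[a], replicate (nat l) a @ [b]}"
  have reps: "replicate k a \<in> ?P" for k
    by (auto simp: nonneg_walks_def dest!: prefix_replicateD)
  show "finite ?F" by simp
  show "[] \<notin> ?F" by simp
  have "replicate (nat l) a @ [b] \<in> ?P"
    using reps assms by (auto simp: nonneg_walks_append prefix_Cons)
  thus "?F \<subseteq> ?P" using reps[of 1] by simp
  show "\<exists>p f q. v = p @ f @ q \<and> f \<in> ?F \<and> p @ q \<in> ?P" if v: "v \<in> ?P" "v \<noteq> []" for v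
  proof (cases "b \<in> set v")
    case False
    then obtain k where k: "v = replicate (Suc k) a"
      using no_b_replicate[OF False] v(2) by (cases v) auto
    thus ?thesis using reps[of k]
      by (intro exI[of _ "[]"] exI[of _ "[a]"] exI[of _ "replicate k a"]) simp
  next
    case True
    then obtain p q where pq: "v = p @ b # q" "b \<notin> set p" by (meson split_list_first)
    define k where "k = length p"
    have p: "p = replicate k a" using no_b_replicate[OF pq(2)] by (simp add: k_def)
    have "prefix (p @ [b]) v" using pq(1) by simp
    hence "0 \<le> wt (- l) 1 (p @ [b])" using v(1) unfolding nonneg_walks_def by blast
    hence k: "nat l \<le> k" using p by simp
    have p': "p = replicate (k - nat l) a @ replicate (nat l) a"
      using k p by (metis le_add_diff_inverse2 replicate_add)
    have "replicate (k - nat l) a @ q \<in> ?P"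
      using v(1) reps assms k unfolding pq(1) p
      by (auto simp: nonneg_walks_append prefix_Cons of_nat_diff)
    thus ?thesis using pq(1) p'
      by (intro exI[of _ "replicate (k - nat l) a"] exI[of _ "replicate (nat l) a @ [b]"] exI[of _ q]) simp
  qed
qed

lemma almost_full_down_walks:
  assumes "l \<ge> 0"
  shows "almost_full (shuffle_le (nonneg_walks l (- 1))) (nonneg_walks l (- 1))"
proof (rule almost_full_shuffle_le[OF shuffle_closed_nonneg_walks])
  let ?P = "nonneg_walks l (- 1)" and ?F = "(\<lambda>j. b # replicate j a) ` {..nat l}"
  show "finite ?F" by simp
  show "[] \<notin> ?F" by auto
  show "?F \<subseteq> ?P" using assms
    by (auto simp: nonneg_walks_def prefix_Cons dest!: prefix_replicateD)
  show "\<exists>p f q. v = p @ f @ q \<and> f \<in> ?F \<and> p @ q \<in> ?P" if v: "v \<in> ?P" "v \<noteq> []" for v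
  proof (cases "b \<in> set v")
    case False
    then obtain k where k: "v = a # replicate k a"
      using no_b_replicate[OF False] v(2) by (cases v) auto
    hence "prefix [a] v" by simp
    hence "0 \<le> wt l (- 1) [a]" using v(1) unfolding nonneg_walks_def by blast
    thus ?thesis by simp
  next
    case True
    then obtain p q where pq: "v = p @ b # q" "b \<notin> set q" by (meson split_list_last)
    define k where "k = length q"
    define j where "j = min k (nat l)"
    have q: "q = replicate j a @ replicate (k - j) a"
    proof -
      have "q = replicate (j + (k - j)) a"
        using no_b_replicate[OF pq(2)] by (simp add: k_def j_def)
      thus ?thesis by (simp only: replicate_add)
    qed
    have "0 \<le> wt l (- 1) p + wt l (- 1) r" if r: "prefix r (replicate (k - j) a)" for r
    proof -
      \<comment> \<open>If some \<open>a\<close> survives after the deletion, then j = l and a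
        factor of weight 0 was removed; otherwise the walk ends with \<open>p\<close>.\<close>
      obtain t where t: "t \<le> k - j" "r = replicate t a" using prefix_replicateD[OF r] by blast
      show ?thesis
      proof (cases "t = 0")
        case True
        thus ?thesis using v(1) t pq(1) by (auto simp: nonneg_walks_def)
      next
        case False
        hence j: "j = nat l" using t by (auto simp: j_def)
        have "prefix (p @ b # replicate j a @ replicate t a) v"
        proof -
          have "replicate (k - j) a = replicate t a @ replicate (k - j - t) a"
            using t(1) by (simp flip: replicate_add)
          thus ?thesis unfolding pq(1) q by simp
        qed
        hence "0 \<le> wt l (- 1) (p @ b # replicate j a @ replicate t a)"
          using v(1) unfolding nonneg_walks_def by blast
        thus ?thesis using t j assms by simp
      qed
    qed
    hence "p @ replicate (k - j) a \<in> ?P"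
      using v(1) unfolding pq(1) by (simp add: nonneg_walks_append)
    moreover have "b # replicate j a \<in> ?F" by (simp add: j_def)
    ultimately show ?thesis using pq(1) q
      by (intro exI[of _ p] exI[of _ "b # replicate j a"] exI[of _ "replicate (k - j) a"]) simp
  qed
qed

section \<open>Splitting a word into labelled copies\<close>

fun attach :: "nat list \<Rightarrow> nat list \<Rightarrow> word \<Rightarrow> (letter \<times> nat) list" where
  "attach A B [] = []"
| "attach A B (a # v) = (a, hd A) # attach (tl A) B v"
| "attach A B (b # v) = (b, hd B) # attach A (tl B) v"

definition part :: "nat \<Rightarrow> nat list \<Rightarrow> nat list \<Rightarrow> word \<Rightarrow> word" where
  "part r A B v = map fst (filter (\<lambda>p. snd p = r) (attach A B v))"

lemma map_fst_attach [simp]: "map fst (attach A B v) = v"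
  by (induction A B v rule: attach.induct) auto

lemma attach_append:
  "attach A B (p @ q) = attach A B p @ attach (drop (count_list p a) A) (drop (count_list p b) B) q"
  by (induction A B p rule: attach.induct) (auto simp: drop_Suc)

lemma count_part:
  assumes "count_list v a \<le> length A" "count_list v b \<le> length B"
  shows "count_list (part r A B v) a = count_list (take (count_list v a) A) r"
    and "count_list (part r A B v) b = count_list (take (count_list v b) B) r"
proof -
  have "count_list (part r A B v) a = count_list (take (count_list v a) A) r \<and>
        count_list (part r A B v) b = count_list (take (count_list v b) B) r"
    using assms
  proof (induction A B v rule: attach.induct)
    case (2 A B v)
    then obtain l A' where "A = l # A'" by (cases A) auto
    thus ?case using 2 by (auto simp: part_def)
  next
    case (3 A B v)
    then obtain l B' where "B = l # B'" by (cases B) auto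
    thus ?case using 3 by (auto simp: part_def)
  qed (simp add: part_def)
  thus "count_list (part r A B v) a = count_list (take (count_list v a) A) r"
    and "count_list (part r A B v) b = count_list (take (count_list v b) B) r" by auto
qed

lemma labels_attach:
  assumes "count_list v a \<le> length A" "count_list v b \<le> length B" "p \<in> set (attach A B v)"
  shows "snd p \<in> set A \<union> set B"
  using assms
proof (induction A B v rule: attach.induct)
  case (2 A B v)
  then obtain l A' where "A = l # A'" by (cases A) auto
  thus ?case using 2 by auto
next
  case (3 A B v)
  then obtain l B' where "B = l # B'" by (cases B) auto
  thus ?case using 3 by auto
qed simp

lemma prefix_filterD: "prefix t (filter P xs) \<Longrightarrow> \<exists>q. prefix q xs \<and> t = filter P q"
proof (induction xs arbitrary: t)
  case (Cons x xs)
  show ?case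
  proof (cases "P x \<and> t \<noteq> []")
    case True
    then obtain t' where t: "t = x # t'" "prefix t' (filter P xs)" using Cons.prems by (cases t) auto
    then obtain q where "prefix q xs" "t' = filter P q" using Cons.IH by blast
    thus ?thesis using t True by (intro exI[of _ "x # q"]) auto
  next
    case False
    show ?thesis
    proof (cases "t = []")
      case True
      thus ?thesis by (intro exI[of _ "[]"]) auto
    next
      case t: False
      hence "\<not> P x" using False by blast
      then obtain q where "prefix q xs" "t = filter P q" using Cons by auto
      thus ?thesis using \<open>\<not> P x\<close> by (intro exI[of _ "x # q"]) auto
    qed
  qed
qed simp

text \<open>Prefixes of one copy arise from moments in the service of the whole word, where
  \<open>count_part\<close> tells how many letters that copy has received.\<close>

lemma prefix_partD:
  assumes "prefix t (part r A B v)"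
  shows "\<exists>p. prefix p v \<and> t = part r A B p"
proof -
  obtain t' where t': "prefix t' (filter (\<lambda>p. snd p = r) (attach A B v))" "t = map fst t'"
    using assms by (auto simp: part_def prefix_def map_eq_append_conv)
  then obtain q where q: "prefix q (attach A B v)" "t' = filter (\<lambda>p. snd p = r) q"
    using prefix_filterD by blast
  define p where "p = map fst q"
  obtain s where s: "attach A B v = q @ s" using q(1) by (auto simp: prefix_def)
  hence v: "v = p @ map fst s" unfolding p_def by (metis map_append map_fst_attach)
  hence "length (attach A B p) = length q"
    by (metis length_map map_fst_attach p_def)
  hence "attach A B p = q" using s unfolding v attach_append by simp
  thus ?thesis using v t' q by (intro exI[of _ p]) (auto simp: part_def)
qed

text \<open>The copy with the largest label is peeled off; putting it back is one insertion
  step.\<close>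

lemma shuffle_parts_in_L_eps:
  assumes "\<And>r. r < N \<Longrightarrow> map fst (filter (\<lambda>p. snd p = r) vl) \<in> I"
    and "\<And>p. p \<in> set vl \<Longrightarrow> snd p < (N :: nat)"
  shows "map fst vl \<in> L_eps I"
  using assms
proof (induction N arbitrary: vl)
  case 0
  hence "vl = []" by (cases vl) auto
  thus ?case by (simp add: L_eps_def ins_star_def)
next
  case (Suc N)
  let ?vl = "filter (\<lambda>p. \<not> snd p = N) vl" and ?u = "filter (\<lambda>p. snd p = N) vl"
  have "map fst ?vl \<in> L_eps I"
  proof (rule Suc.IH)
    fix r assume r: "r < N"
    have "filter (\<lambda>p. snd p = r) ?vl = filter (\<lambda>p. snd p = r) vl"
      using r by (auto intro: filter_cong)
    thus "map fst (filter (\<lambda>p. snd p = r) ?vl) \<in> I" using Suc.prems(1)[of r] r by simp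
  next
    fix p assume "p \<in> set ?vl"
    thus "snd p < N" using Suc.prems(2)[of p] by auto
  qed
  moreover have "vl \<in> shuffles ?vl ?u"
    using partition_in_shuffles[of vl "\<lambda>p. snd p = N"] by (simp add: shuffles_commutes)
  hence "ins_step I (map fst ?vl) (map fst vl)"
    unfolding ins_step_def using shuffles_map[of vl ?vl ?u fst] Suc.prems(1)[of N] by blast
  ultimately show ?case
    unfolding L_eps_def ins_star_def by (auto intro: rtranclp.rtrancl_into_rtrancl)
qed

text \<open>Induction along a derivation of \<open>z\<close>: by associativity the word inserted
  last into \<open>z\<close> can also be inserted last into \<open>w\<close>. This turns the goal
  into finding a derivable remainder.\<close>

lemma ins_star_shuffle:
  assumes "z \<in> L_eps I" "w \<in> shuffles v z"
  shows "ins_star I v w"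
proof -
  have "(ins_step I)\<^sup>*\<^sup>* [] z" using assms(1) by (simp add: L_eps_def ins_star_def)
  hence "\<forall>w. w \<in> shuffles v z \<longrightarrow> ins_star I v w"
  proof (induction rule: rtranclp_induct)
    case base
    thus ?case by (auto simp: ins_star_def)
  next
    case (step y z)
    show ?case
    proof (intro allI impI)
      fix w assume w: "w \<in> shuffles v z"
      obtain u where u: "u \<in> I" "z \<in> shuffles y u" using step(2) by (auto simp: ins_step_def)
      obtain v' where v': "w \<in> shuffles v' u" "v' \<in> shuffles v y"
        using shuffles_assoc'[OF w u(2)] by blast
      have "ins_star I v v'" using step.IH v'(2) by blast
      moreover have "ins_step I v' w" using v'(1) u(1) by (auto simp: ins_step_def)
      ultimately show "ins_star I v w" unfolding ins_star_def by (rule rtranclp.rtrancl_into_rtrancl)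
    qed
  qed
  thus ?thesis using assms(2) by blast
qed

lemma count_ab: "count_list w a + count_list w b = length w"
proof (induction w)
  case (Cons x w)
  thus ?case by (cases x) auto
qed simp

lemma eq_by_prefix_counts:
  assumes len: "length x = length y"
    and eq: "\<And>k. k \<le> length x \<Longrightarrow> count_list (take k x) b = count_list (take k y) b"
  shows "x = y"
proof (rule nth_equalityI[OF len])
  fix k assume k: "k < length x"
  have "count_list (take (Suc k) x) b = count_list (take (Suc k) y) b"
    using eq[of "Suc k"] k by simp
  hence "x ! k = b \<longleftrightarrow> y ! k = b"
    using eq[of k] k len by (simp add: take_Suc_conv_app_nth split: if_splits)
  thus "x ! k = y ! k" by (metis letter.exhaust)
qed

lemma count_take_ge:
  assumes "xs = p @ q" "length p \<le> k"
  shows "count_list p r \<le> count_list (take k xs) r"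
  using assms by simp

lemma count_take_le:
  assumes "xs = p @ q" "k \<le> length p"
  shows "count_list (take k xs) r \<le> count_list p r"
proof -
  have "count_list (take k p) r + count_list (drop k p) r = count_list p r"
    by (metis append_take_drop_id count_list_append)
  thus ?thesis using assms by simp
qed

section \<open>Label lists that serve the copies in turn\<close>

definition row :: "nat \<Rightarrow> nat \<Rightarrow> nat list" where
  "row k N = concat (map (replicate k) [0..<N])"

lemma row_Suc: "row k (Suc N) = row k N @ replicate k N"
  by (simp add: row_def)

lemma length_row [simp]: "length (row k N) = k * N"
  by (induction N) (simp_all add: row_Suc, simp add: row_def)

lemma count_list_replicate: "count_list (replicate k x) y = (if x = y then k else 0)"
  by (induction k) auto

lemma count_row [simp]: "count_list (row k N) r = (if r < N then k else 0)"
  by (induction N) (auto simp: row_Suc count_list_replicate, simp add: row_def)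

lemma set_row: "set (row k N) \<subseteq> {..<N}"
  by (auto simp: row_def)

lemma row_split: "r \<le> N \<Longrightarrow> \<exists>q. row k N = row k r @ q"
proof -
  assume "r \<le> N"
  hence "[0..<N] = [0..<r] @ [r..<N]" by (metis le_add_diff_inverse upt_add_eq_append zero_le)
  thus ?thesis by (simp add: row_def)
qed

lemma concat_replicate_split:
  assumes "s < J"
  shows "\<exists>q. concat (replicate J x) = concat (replicate s x) @ x @ q"
proof -
  have "replicate J x = replicate s x @ replicate (Suc (J - Suc s)) x"
    using assms by (metis replicate_add add_Suc_shift le_add_diff_inverse Suc_leI add_Suc)
  thus ?thesis by simp
qed

lemma length_concat_replicate [simp]: "length (concat (replicate s x)) = s * length x"
  by (induction s) simp_all

lemma count_concat_replicate [simp]: "count_list (concat (replicate s x)) r = s * count_list x r"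
  by (induction s) simp_all

section \<open>Shuffles of staircase words as walks between two bounds\<close>

text \<open>A triple \<open>(\<alpha>, \<beta>, \<gamma>)\<close> stands for the constraint \<open>\<alpha> x + \<beta> y + \<gamma> N \<ge> 0\<close> on a prefix with \<open>x\<close>
  letters \<open>b\<close> and \<open>y\<close> letters \<open>a\<close> of a shuffle of \<open>N\<close> words.\<close>

fun slack :: "int \<times> int \<times> int \<Rightarrow> int \<Rightarrow> int \<Rightarrow> int \<Rightarrow> int" where
  "slack (\<alpha>, \<beta>, \<gamma>) N x y = \<alpha> * x + \<beta> * y + \<gamma> * N"

definition within ::
  "int \<times> int \<times> int \<Rightarrow> int \<times> int \<times> int \<Rightarrow> int \<Rightarrow> int \<Rightarrow> int \<Rightarrow> word \<Rightarrow> bool" where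
  "within lo up N x y v \<longleftrightarrow> (\<forall>p. prefix p v \<longrightarrow>
     0 \<le> slack lo N (x + nb p) (y + na p) \<and> 0 \<le> slack up N (x + nb p) (y + na p))"

text \<open>The two conditional assumptions record the two shapes of \<open>w\<close>: the empty
  word gives J = 0 and c = n, a nonempty \<open>w\<close> gives J > 0, and then m <= n follows from
  goodness.\<close>

locale staircase =
  fixes c n J m :: nat
  assumes n_pos: "1 \<le> n" and m_pos: "1 \<le> m" and c_le: "c \<le> n"
    and c_eq: "J = 0 \<Longrightarrow> c = n" and m_le: "J \<noteq> 0 \<Longrightarrow> m \<le> n"
begin

definition stem :: word where
  "stem = replicate c a @ concat (replicate J (b # replicate n a))"

text \<open>Lower bound: x letters \<open>b\<close> require c letters \<open>a\<close> each as long
  as they are first ones, which serving in turn ensures up to x = N, and n for each further one: c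
  x, then c N + n (x - N). Upper bound: each \<open>b\<close> makes room for n letters
  \<open>a\<close> up to x = J N and for m afterwards: c N + n x, then c N + J n N + m (x - J
  N).\<close>

definition lo1 :: "int \<times> int \<times> int" where "lo1 = (- int c, 1, 0)"
definition lo2 :: "int \<times> int \<times> int" where "lo2 = (- int n, 1, int n - int c)"
definition up1 :: "int \<times> int \<times> int" where "up1 = (int n, - 1, int c)"
definition up2 :: "int \<times> int \<times> int" where "up2 = (int m, - 1, int c + int J * int n - int J * int m)"

text \<open>\<open>N\<close> counts all copies, \<open>N1\<close> those with a \<open>b\<close> after the stem, \<open>N2\<close> those with the tail \<open>a\<^sup>m\<close>.\<close>

definition balanced :: "nat \<Rightarrow> nat \<Rightarrow> nat \<Rightarrow> word \<Rightarrow> bool" where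
  "balanced N N1 N2 v \<longleftrightarrow> N2 \<le> N1 \<and> N1 \<le> N \<and>
     count_list v b = J * N + N1 \<and> count_list v a = (c + J * n) * N + m * N2"

text \<open>The bounds have corners at \<open>x = N\<close> (lower) and \<open>x = J N\<close> (upper), where two constraints are tight at
  once. The walk is therefore cut there; for \<open>J = 0\<close> the first two parts contain no \<open>b\<close>.\<close>

definition in_region :: "nat \<Rightarrow> word \<Rightarrow> word \<Rightarrow> word \<Rightarrow> bool" where
  "in_region N R0 R1 R2 \<longleftrightarrow>
     count_list R0 b = min J 1 * N \<and> count_list R1 b = (J - min J 1) * N \<and>
     within lo1 up1 (int N) 0 0 R0 \<and>
     within lo2 up1 (int N) (nb R0) (na R0) R1 \<and>
     within lo2 up2 (int N) (nb (R0 @ R1)) (na (R0 @ R1)) R2"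

definition good_point :: "int \<Rightarrow> int \<Rightarrow> int \<Rightarrow> bool" where
  "good_point N x y \<longleftrightarrow>
     (J \<noteq> 0 \<and> x \<le> N \<and> int c * x \<le> y \<and> y \<le> int n * x + int c * N) \<or>
     (J \<noteq> 0 \<and> N \<le> x \<and> x \<le> int J * N \<and> int n * x \<le> y + (int n - int c) * N \<and> y \<le> int n * x + int c * N) \<or>
     (int J * N \<le> x \<and> int n * x \<le> y + (int n - int c) * N \<and>
      y + int m * int J * N \<le> (int c + int J * int n) * N + int m * x)"

lemma region_good_point:
  assumes R: "in_region N R0 R1 R2" and p: "prefix p (R0 @ R1 @ R2)"
  shows "good_point (int N) (nb p) (na p)"
proof -
  have count_mono: "nb q \<le> nb r" if "prefix q r" for q r
    using that by (auto simp: prefix_def)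
  consider (0) "prefix p R0" | (1) q where "p = R0 @ q" "prefix q R1"
    | (2) q where "p = R0 @ R1 @ q" "prefix q R2"
    using p by (auto simp: prefix_append)
  thus ?thesis
  proof cases
    case 0
    hence "0 \<le> slack lo1 (int N) (nb p) (na p)" "0 \<le> slack up1 (int N) (nb p) (na p)"
      using R by (auto simp: in_region_def within_def)
    moreover have "count_list p b \<le> min J 1 * N"
      using count_mono[OF 0] R by (simp add: in_region_def)
    ultimately show ?thesis using c_eq unfolding good_point_def lo1_def up1_def
      by (cases "J = 0") (auto simp: algebra_simps)
  next
    case 1
    hence *: "0 \<le> slack lo2 (int N) (nb p) (na p)" "0 \<le> slack up1 (int N) (nb p) (na p)"
      using R by (auto simp: in_region_def within_def add.commute)
    have "count_list q b \<le> (J - min J 1) * N"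
      using count_mono[OF 1(2)] R by (simp add: in_region_def)
    hence x: "count_list p b \<le> J * N" "min J 1 * N \<le> count_list p b"
      using 1 R by (auto simp: in_region_def min_def algebra_simps split: if_splits)
        (cases J; simp)
    show ?thesis
    proof (cases "J = 0")
      case True
      thus ?thesis using * x c_eq unfolding good_point_def lo2_def up1_def
        by (simp add: algebra_simps)
    next
      case False
      have "nb p \<le> int J * int N" using x(1) by (metis of_nat_le_iff of_nat_mult)
      moreover have "min J 1 = 1" using False by simp
      hence "int N \<le> nb p" using x(2) by simp
      ultimately show ?thesis using * False
        by (simp add: good_point_def lo2_def up1_def algebra_simps)
    qed
  next
    case 2
    have "nb p = nb (R0 @ R1) + nb q" "na p = na (R0 @ R1) + na q" using 2(1) by simp_all
    moreover have "within lo2 up2 (int N) (nb (R0 @ R1)) (na (R0 @ R1)) R2"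
      using R unfolding in_region_def by blast
    ultimately have *: "0 \<le> slack lo2 (int N) (nb p) (na p)" "0 \<le> slack up2 (int N) (nb p) (na p)"
      using 2(2) unfolding within_def by metis+
    have "count_list R0 b + count_list R1 b = (min J 1 + (J - min J 1)) * N"
      using R unfolding in_region_def add_mult_distrib by simp
    hence "J * N \<le> count_list p b" using 2(1) by simp
    hence "int J * int N \<le> nb p" by (metis of_nat_le_iff of_nat_mult)
    thus ?thesis using *
      by (simp add: good_point_def lo2_def up2_def algebra_simps)
  qed
qed

text \<open>Copy \<open>r\<close> receives its (s+1)-st \<open>b\<close> as number s N + r + 1 of
  all. The bound on \<open>y\<close> is the position in the label list of \<open>a\<close> at which
  the block of copy \<open>r\<close> preceding that \<open>b\<close> is complete.\<close>

lemma good_point_lower: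
  fixes N r s :: nat and x y :: int
  assumes g: "good_point (int N) x y" and r: "r < N" and s: "s \<le> J" and x: "int (s * N + r + 1) \<le> x"
  shows "(if s = 0 then int (c * (r + 1)) else int (c * N + (s - 1) * (n * N) + n * (r + 1))) \<le> y"
proof (cases "s = 0")
  case True
  have cr: "int c * (int r + 1) \<le> int c * int N"
    using r by (intro mult_left_mono) auto
  from g consider (0) "int c * x \<le> y" | (2) "J \<noteq> 0" "int N \<le> x" "int n * x \<le> y + (int n - int c) * int N"
    | (3) "J = 0" "int n * x \<le> y + (int n - int c) * int N"
    unfolding good_point_def
  proof (elim disjE conjE)
    assume *: "int J * int N \<le> x" "int n * x \<le> y + (int n - int c) * int N"
    have "int N \<le> x" if "J \<noteq> 0"
    proof -
      have "1 * int N \<le> int J * int N" using that by (intro mult_right_mono) auto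
      thus ?thesis using * by simp
    qed
    thus ?thesis using that * by blast
  qed (use that in blast)+
  thus ?thesis
  proof cases
    case 0
    have "int c * (int r + 1) \<le> int c * x" using x True by (intro mult_left_mono) auto
    thus ?thesis using 0 True by (simp add: algebra_simps)
  next
    case 2
    have "int n * int N \<le> int n * x" using 2 by (intro mult_left_mono) auto
    thus ?thesis using 2 cr True by (simp add: algebra_simps)
  next
    case 3
    have "int n * (int r + 1) \<le> int n * x" using x True by (intro mult_left_mono) auto
    thus ?thesis using 3 True c_eq by (simp add: algebra_simps)
  qed
next
  case False
  have "1 * int N \<le> int s * int N" using False by (intro mult_right_mono) auto
  hence "int N < x" using x by simp
  hence l: "int n * x \<le> y + (int n - int c) * int N" using g by (auto simp: good_point_def)
  have "int n * (int s * int N + int r + 1) \<le> int n * x" using x by (intro mult_left_mono) auto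
  hence "int n * (int s * int N + int r + 1) \<le> y + (int n - int c) * int N" using l by linarith
  moreover obtain s' where "s = Suc s'" using False by (cases s) auto
  ultimately show ?thesis by (simp add: algebra_simps)
qed

text \<open>As long as x <= s N + r, copy \<open>r\<close> has at most s letters \<open>b\<close>.
  The bound on \<open>y\<close> is the position at which its next block of \<open>a\<close> would
  begin; for s = J this block is the tail, hence the step m.\<close>

lemma good_point_upper:
  fixes N r s :: nat and x y :: int
  assumes g: "good_point (int N) x y" and r: "r < N" and s: "s \<le> J" and x: "x \<le> int (s * N + r)"
  shows "y \<le> (if s < J then int (c * N + s * (n * N) + n * r) else int (c * N + J * (n * N) + m * r))"
proof (cases "s < J")
  case True
  have "int (Suc s) * int N \<le> int J * int N" using True by (intro mult_right_mono) auto
  hence "x < int J * int N" using x r by (simp add: algebra_simps)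
  hence u: "y \<le> int n * x + int c * int N" using g by (auto simp: good_point_def)
  have "int n * x \<le> int n * (int s * int N + int r)" using x by (intro mult_left_mono) auto
  thus ?thesis using True u by (simp add: algebra_simps)
next
  case False
  hence s: "s = J" using s by simp
  from g consider (1) "x \<le> int J * int N" "y \<le> int n * x + int c * int N"
    | (2) "y + int m * int J * int N \<le> (int c + int J * int n) * int N + int m * x"
    unfolding good_point_def
  proof (elim disjE conjE)
    assume *: "J \<noteq> 0" "x \<le> int N" "y \<le> int n * x + int c * int N"
    have "1 * int N \<le> int J * int N" using *(1) by (intro mult_right_mono) auto
    thus ?thesis using that * by simp
  qed (use that in blast)+
  thus ?thesis
  proof cases
    case 1
    have "int n * x \<le> int n * (int J * int N)" using 1 by (intro mult_left_mono) auto
    moreover have "0 \<le> int m * int r" by simp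
    ultimately have "y \<le> int n * (int J * int N) + int c * int N + int m * int r" using 1 by linarith
    thus ?thesis using s by (simp add: algebra_simps)
  next
    case 2
    have "int m * x \<le> int m * (int J * int N + int r)" using x s by (intro mult_left_mono) auto
    thus ?thesis using 2 s by (simp add: algebra_simps)
  qed
qed

section \<open>Prefix counts that determine a single copy\<close>

definition stair :: "word \<Rightarrow> bool" where
  "stair p \<longleftrightarrow> (\<forall>s. count_list p b = Suc s \<longrightarrow> s \<le> J \<and> c + s * n \<le> count_list p a) \<and>
     (count_list p b \<le> J \<longrightarrow> count_list p a \<le> c + count_list p b * n)"

text \<open>Of two \<open>stair\<close> prefixes, the one with more letters \<open>b\<close> has at
  least as many letters \<open>a\<close>, so they cannot have equal length. \<open>stair\<close>
  does not bound the \<open>a\<close> after the last \<open>b\<close>; the given length settles the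
  tail.\<close>

lemma stair_unique:
  assumes len: "length x = length y"
    and x: "\<And>p. prefix p x \<Longrightarrow> stair p" and y: "\<And>p. prefix p y \<Longrightarrow> stair p"
  shows "x = y"
proof -
  have less: "\<not> count_list p b < count_list q b" if "stair p" "stair q" "length p = length q" for p q
  proof
    assume lt: "count_list p b < count_list q b"
    then obtain s where s: "count_list q b = Suc s" "count_list p b \<le> s" by (cases "count_list q b") auto
    have "s \<le> J" "c + s * n \<le> count_list q a" using that(2) s(1) by (auto simp: stair_def)
    moreover have "count_list p a \<le> c + count_list p b * n"
      using that(1) s(2) \<open>s \<le> J\<close> by (auto simp: stair_def)
    moreover have "count_list p b * n \<le> s * n" using s(2) by simp
    ultimately have "count_list p a \<le> count_list q a" by linarith
    thus False using lt count_ab[of p] count_ab[of q] that(3) by linarith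
  qed
  show ?thesis
  proof (rule eq_by_prefix_counts[OF len])
    fix k assume "k \<le> length x"
    thus "count_list (take k x) b = count_list (take k y) b"
      using less[of "take k x" "take k y"] less[of "take k y" "take k x"] x[OF take_is_prefix] y[OF take_is_prefix] len
      by (auto simp: min_def)
  qed
qed

lemma stair_stem:
  assumes "prefix p (stem @ b # replicate m a)"
  shows "stair p"
proof -
  have rows: "stair (replicate c a @ concat (replicate s (b # replicate n a)) @ b # replicate j a)"
    if "s < J" "j \<le> n" for s j
    using that by (auto simp: stair_def count_list_replicate algebra_simps)
  consider (0) j where "j \<le> c" "p = replicate j a"
    | (1) q where "p = replicate c a @ q" "prefix q (concat (replicate J (b # replicate n a)))"
    | (2) j where "p = stem @ b # replicate j a"
    using assms by (auto simp: stem_def prefix_append prefix_Cons dest!: prefix_replicateD)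
  thus ?thesis
  proof cases
    case 0
    thus ?thesis by (auto simp: stair_def count_list_replicate)
  next
    case 1
    have "q = [] \<or> (\<exists>s j. s < K \<and> j \<le> n \<and> q = concat (replicate s (b # replicate n a)) @ b # replicate j a)"
      if "prefix q (concat (replicate K (b # replicate n a)))" for K
      using that
    proof (induction K arbitrary: q)
      case (Suc K)
      then consider "q = []" | j where "j \<le> n" "q = b # replicate j a"
        | q' where "q = b # replicate n a @ q'" "prefix q' (concat (replicate K (b # replicate n a)))"
        by (auto simp: prefix_Cons prefix_append dest!: prefix_replicateD)
      thus ?case
      proof cases
        case 2
        thus ?thesis by (intro disjI2 exI[of _ 0] exI[of _ j]) simp
      next
        case 3
        from Suc.IH[OF 3(2)] show ?thesis
        proof
          assume "q' = []"
          thus ?thesis using 3 by (intro disjI2 exI[of _ 0] exI[of _ n]) simp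
        next
          assume "\<exists>s j. s < K \<and> j \<le> n \<and> q' = concat (replicate s (b # replicate n a)) @ b # replicate j a"
          then obtain s j where "s < K" "j \<le> n" "q' = concat (replicate s (b # replicate n a)) @ b # replicate j a"
            by blast
          thus ?thesis using 3 by (intro disjI2 exI[of _ "Suc s"] exI[of _ j]) simp
        qed
      qed simp
    qed simp
    from this[OF 1(2)] show ?thesis
    proof
      assume "q = []"
      thus ?thesis using 1 by (auto simp: stair_def count_list_replicate)
    next
      assume "\<exists>s j. s < J \<and> j \<le> n \<and> q = concat (replicate s (b # replicate n a)) @ b # replicate j a"
      thus ?thesis using 1 rows by auto
    qed
  next
    case 2
    thus ?thesis by (auto simp: stair_def stem_def count_list_replicate)
  qed
qed

section \<open>Positions of a copy in the label lists\<close>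

definition copy_labels_a :: "nat \<Rightarrow> nat \<Rightarrow> nat list" where
  "copy_labels_a N N2 = row c N @ concat (replicate J (row n N)) @ row m N2"

definition copy_labels_b :: "nat \<Rightarrow> nat \<Rightarrow> nat list" where
  "copy_labels_b N N1 = concat (replicate J (row 1 N)) @ row 1 N1"

lemma copy_labels_b_lower:
  assumes "r < N" "s < J \<or> s = J \<and> r < N1" "s * N + r + 1 \<le> k"
  shows "s + 1 \<le> count_list (take k (copy_labels_b N N1)) r"
proof -
  have "\<exists>q. copy_labels_b N N1 = (concat (replicate s (row 1 N)) @ row 1 (Suc r)) @ q"
    using assms(1,2) concat_replicate_split[of s J "row 1 N"]
      row_split[of "Suc r" N 1] row_split[of "Suc r" N1 1]
    unfolding copy_labels_b_def by auto
  then obtain q where q: "copy_labels_b N N1 = (concat (replicate s (row 1 N)) @ row 1 (Suc r)) @ q" ..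
  show ?thesis using count_take_ge[OF q, of k r] assms by simp
qed

lemma copy_labels_b_upper:
  assumes "r < N" "s \<le> J" "k \<le> s * N + r"
  shows "count_list (take k (copy_labels_b N N1)) r \<le> s"
proof (cases "s < J \<or> s = J \<and> r < N1")
  case True
  have "\<exists>q. copy_labels_b N N1 = (concat (replicate s (row 1 N)) @ row 1 r) @ q"
    using assms(1) True concat_replicate_split[of s J "row 1 N"]
      row_split[of r N 1] row_split[of r N1 1]
    unfolding copy_labels_b_def by auto
  then obtain q where q: "copy_labels_b N N1 = (concat (replicate s (row 1 N)) @ row 1 r) @ q" ..
  show ?thesis using count_take_le[OF q, of k r] assms by simp
next
  case False
  hence "s = J" "\<not> r < N1" using assms by auto
  have "count_list (take k (copy_labels_b N N1)) r \<le> count_list (copy_labels_b N N1) r"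
    by (metis append_take_drop_id count_list_append le_add1)
  thus ?thesis using assms \<open>s = J\<close> \<open>\<not> r < N1\<close> by (simp add: copy_labels_b_def)
qed

lemma copy_labels_a_lower:
  assumes "r < N" "s \<le> J"
    "(if s = 0 then c * (r + 1) else c * N + (s - 1) * (n * N) + n * (r + 1)) \<le> k"
  shows "c + s * n \<le> count_list (take k (copy_labels_a N N2)) r"
proof (cases "s = 0")
  case True
  obtain q where q: "copy_labels_a N N2 = row c (Suc r) @ q"
    using assms(1) row_split[of "Suc r" N c] unfolding copy_labels_a_def by auto
  show ?thesis using count_take_ge[OF q, of k r] assms True by simp
next
  case False
  then obtain s' where s': "s = Suc s'" by (cases s) auto
  have "\<exists>q. copy_labels_a N N2 = (row c N @ concat (replicate s' (row n N)) @ row n (Suc r)) @ q"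
    using assms(1,2) s' concat_replicate_split[of s' J "row n N"] row_split[of "Suc r" N n]
    unfolding copy_labels_a_def by auto
  then obtain q where q: "copy_labels_a N N2 = (row c N @ concat (replicate s' (row n N)) @ row n (Suc r)) @ q" ..
  show ?thesis using count_take_ge[OF q, of k r] assms s' by (simp add: algebra_simps)
qed

lemma copy_labels_a_upper:
  assumes "r < N" "s \<le> J"
    "k \<le> (if s < J then c * N + s * (n * N) + n * r else c * N + J * (n * N) + m * r)"
  shows "count_list (take k (copy_labels_a N N2)) r \<le> c + s * n"
proof -
  consider (1) "s < J" | (2) "s = J" "r < N2" | (3) "s = J" "\<not> r < N2" using assms by linarith
  thus ?thesis
  proof cases
    case 1
    have "\<exists>q. copy_labels_a N N2 = (row c N @ concat (replicate s (row n N)) @ row n r) @ q"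
      using assms(1) 1 concat_replicate_split[of s J "row n N"] row_split[of r N n]
      unfolding copy_labels_a_def by auto
    then obtain q where q: "copy_labels_a N N2 = (row c N @ concat (replicate s (row n N)) @ row n r) @ q" ..
    show ?thesis using count_take_le[OF q, of k r] assms 1 by (simp add: algebra_simps)
  next
    case 2
    obtain q where q: "copy_labels_a N N2 = (row c N @ concat (replicate J (row n N)) @ row m r) @ q"
      using 2 row_split[of r N2 m] unfolding copy_labels_a_def by auto
    show ?thesis using count_take_le[OF q, of k r] assms 2 by (simp add: algebra_simps)
  next
    case 3
    have "count_list (take k (copy_labels_a N N2)) r \<le> count_list (copy_labels_a N N2) r"
      by (metis append_take_drop_id count_list_append le_add1)
    thus ?thesis using assms 3 by (simp add: copy_labels_a_def)
  qed
qed

definition copy_of :: "nat \<Rightarrow> nat \<Rightarrow> nat \<Rightarrow> word" where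
  "copy_of N1 N2 r = stem @ (if r < N1 then [b] else []) @ (if r < N2 then replicate m a else [])"

text \<open>The copies are served in turn: the \<open>t\<close>-th \<open>b\<close> goes to copy \<open>t mod N\<close>, and likewise for the
  blocks of \<open>a\<close>.\<close>

lemma balanced_region_in_L_eps:
  assumes bal: "balanced N N1 N2 v" and v: "v = R0 @ R1 @ R2" and R: "in_region N R0 R1 R2"
    and I: "\<And>r. r < N \<Longrightarrow> copy_of N1 N2 r \<in> I"
  shows "v \<in> L_eps I"
proof -
  let ?A = "copy_labels_a N N2" and ?B = "copy_labels_b N N1"
  have N: "N2 \<le> N1" "N1 \<le> N" using bal by (auto simp: balanced_def)
  have lenA: "length ?A = count_list v a" and lenB: "length ?B = count_list v b"
    using bal by (simp_all add: balanced_def copy_labels_a_def copy_labels_b_def algebra_simps)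
  \<comment> \<open>The letters sent to copy \<open>r\<close> are not traced explicitly: their
    number is right and all their prefixes are \<open>stair\<close>, so uniqueness identifies
    them.\<close>
  have "part r ?A ?B v = copy_of N1 N2 r" if r: "r < N" for r
  proof (rule stair_unique)
    have "length (part r ?A ?B v) = count_list ?A r + count_list ?B r"
      using count_part[of v ?A ?B r] lenA lenB count_ab[of "part r ?A ?B v"] by simp
    also have "\<dots> = length (copy_of N1 N2 r)"
      using r N by (auto simp: copy_of_def stem_def copy_labels_a_def copy_labels_b_def)
    finally show "length (part r ?A ?B v) = length (copy_of N1 N2 r)" .
  next
    fix p assume "prefix p (copy_of N1 N2 r)"
    moreover have "prefix (copy_of N1 N2 r) (stem @ b # replicate m a)"
      using N by (auto simp: copy_of_def)
    ultimately show "stair p" using stair_stem by (meson prefix_order.trans)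
  next
    fix t assume "prefix t (part r ?A ?B v)"
    then obtain p where p: "prefix p v" "t = part r ?A ?B p" using prefix_partD by blast
    have le: "count_list p a \<le> count_list v a" "count_list p b \<le> count_list v b"
      using p(1) by (auto simp: prefix_def)
    have ta: "count_list t a = count_list (take (count_list p a) ?A) r"
      and tb: "count_list t b = count_list (take (count_list p b) ?B) r"
      using count_part[of p ?A ?B r] le lenA lenB p(2) by simp_all
    have g: "good_point (int N) (nb p) (na p)" using region_good_point[OF R] p(1) v by simp
    show "stair t" unfolding stair_def
    proof (intro conjI allI impI)
      fix s assume s: "count_list t b = Suc s"
      have "count_list t b \<le> count_list ?B r"
        unfolding tb by (metis append_take_drop_id count_list_append le_add1)
      hence "Suc s \<le> J + (if r < N1 then 1 else 0)" using s r by (auto simp: copy_labels_b_def)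
      thus sJ: "s \<le> J" by (auto split: if_splits)
      have "\<not> count_list p b \<le> s * N + r"
        using copy_labels_b_upper[OF r sJ, of "count_list p b" N1] s tb by auto
      hence "s * N + r + 1 \<le> count_list p b" by simp
      hence "int (s * N + r + 1) \<le> nb p" by (simp only: of_nat_le_iff)
      from good_point_lower[OF g r sJ this]
      have "(if s = 0 then c * (r + 1) else c * N + (s - 1) * (n * N) + n * (r + 1)) \<le> count_list p a"
        by (simp split: if_splits del: of_nat_add of_nat_mult)
      thus "c + s * n \<le> count_list t a"
        using copy_labels_a_lower[OF r sJ, of "count_list p a" N2] ta by simp
    next
      assume sJ: "count_list t b \<le> J"
      define s where "s = count_list t b"
      have s: "s \<le> J" using sJ by (simp add: s_def)
      show "count_list t a \<le> c + count_list t b * n"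
      \<comment> \<open>A copy with s = J and r >= N1 never gets another \<open>b\<close>, so its
        number of \<open>b\<close> says nothing about the time. It also has no tail, because N2 <=
        N1, and its total supply of \<open>a\<close> is the bound.\<close>
      proof (cases "s < J \<or> r < N1")
        case True
        hence "s < J \<or> s = J \<and> r < N1" using s by auto
        hence "\<not> s * N + r + 1 \<le> count_list p b"
          using copy_labels_b_lower[OF r, of s N1 "count_list p b"] tb s_def by linarith
        hence "count_list p b \<le> s * N + r" by simp
        hence "nb p \<le> int (s * N + r)" by (simp only: of_nat_le_iff)
        from good_point_upper[OF g r s this]
        have "count_list p a \<le> (if s < J then c * N + s * (n * N) + n * r else c * N + J * (n * N) + m * r)"
          by (simp split: if_splits del: of_nat_add of_nat_mult)
        thus ?thesis using copy_labels_a_upper[OF r s] ta by (simp add: s_def)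
      next
        case False
        hence "s = J" "\<not> r < N2" using s N by auto
        have "count_list t a \<le> count_list ?A r"
          unfolding ta by (metis append_take_drop_id count_list_append le_add1)
        thus ?thesis using r \<open>s = J\<close> \<open>\<not> r < N2\<close> by (simp add: copy_labels_a_def s_def)
      qed
    qed
  qed
  hence "map fst (filter (\<lambda>p. snd p = r) (attach ?A ?B v)) \<in> I" if "r < N" for r
    using I that by (simp add: part_def)
  moreover have "snd p < N" if "p \<in> set (attach ?A ?B v)" for p
  proof -
    have "snd p \<in> set ?A \<union> set ?B" using labels_attach[OF _ _ that] lenA lenB by simp
    moreover have "set ?A \<union> set ?B \<subseteq> {..<N}"
      using set_row[of c N] set_row[of n N] set_row[of m N2] set_row[of 1 N] set_row[of 1 N1] N
      by (auto simp: copy_labels_a_def copy_labels_b_def)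
    ultimately show ?thesis by auto
  qed
  ultimately have "map fst (attach ?A ?B v) \<in> L_eps I" by (rule shuffle_parts_in_L_eps)
  thus ?thesis by simp
qed

end

lemma split_at_count:
  "k \<le> count_list v x \<Longrightarrow> \<exists>p q. v = p @ q \<and> count_list p x = k"
proof (induction v arbitrary: k)
  case (Cons y v)
  show ?case
  proof (cases "k = 0")
    case True
    thus ?thesis by (intro exI[of _ "[]"] exI[of _ "y # v"]) simp
  next
    case False
    define k' where "k' = (if y = x then k - 1 else k)"
    have "k' \<le> count_list v x" using Cons.prems False by (auto simp: k'_def split: if_splits)
    then obtain p q where "v = p @ q" "count_list p x = k'" using Cons.IH by blast
    thus ?thesis using False by (intro exI[of _ "y # p"] exI[of _ q]) (auto simp: k'_def)
  qed
qed simp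

lemma slack_add: "slack q (N + N') (x + x') (y + y') = slack q N x y + slack q N' x' y'"
  by (cases q) (simp add: algebra_simps)

section \<open>Linear constraints met by every derivable word\<close>

context staircase
begin

text \<open>For J = 0 the tail may have m > n, and then the word with the tail itself violates
  \<open>up1\<close>.\<close>

definition constraints :: "(int \<times> int \<times> int) set" where
  "constraints = {lo1, lo2, up2} \<union> (if J = 0 then {} else {up1})"

definition admissible :: "nat \<Rightarrow> nat \<Rightarrow> nat \<Rightarrow> word \<Rightarrow> bool" where
  "admissible N N1 N2 v \<longleftrightarrow> balanced N N1 N2 v \<and>
     (\<forall>p q. prefix p v \<longrightarrow> q \<in> constraints \<longrightarrow>
        0 \<le> slack q (int N) (nb p) (na p))"

text \<open>A prefix of a shuffle is a shuffle of prefixes, and slacks are linear in (N, x, y), so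
  they add up. Each constraint is imposed on the whole word here, without the cuts of
  \<open>in_region\<close>.\<close>

lemma admissible_shuffle:
  assumes "admissible N N1 N2 v" "admissible N' N1' N2' u" "w \<in> shuffles v u"
  shows "admissible (N + N') (N1 + N1') (N2 + N2') w"
  unfolding admissible_def
proof (intro conjI allI impI)
  show "balanced (N + N') (N1 + N1') (N2 + N2') w"
    using assms by (auto simp: admissible_def balanced_def count_list_shuffles algebra_simps)
next
  fix p q assume p: "prefix p w" and q: "q \<in> constraints"
  obtain p1 p2 where p12: "prefix p1 v" "prefix p2 u" "p \<in> shuffles p1 p2"
    using shuffles_prefix[OF assms(3) p] by blast
  have "0 \<le> slack q (int N) (nb p1) (na p1)" "0 \<le> slack q (int N') (nb p2) (na p2)"
    using assms(1,2) p12 q unfolding admissible_def by blast+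
  thus "0 \<le> slack q (int (N + N')) (nb p) (na p)"
    using slack_add[of q "int N" "int N'" "nb p1" "nb p2" "na p1" "na p2"]
      count_list_shuffles[OF p12(3)] by simp
qed

lemma stair_slack:
  assumes st: "stair p" and tail: "count_list p a \<le> c + J * n + m"
    and q: "q \<in> constraints"
  shows "0 \<le> slack q 1 (nb p) (na p)"
proof -
  define y where "y = na p"
  have ytail: "y \<le> int c + int J * int n + int m"
  proof -
    have "int (count_list p a) \<le> int (c + J * n + m)" using tail by (simp only: of_nat_le_iff)
    thus ?thesis by (simp add: y_def)
  qed
  have upper: "y \<le> int c + int (count_list p b) * int n" if "count_list p b \<le> J"
  proof -
    have "count_list p a \<le> c + count_list p b * n" using st that by (auto simp: stair_def)
    hence "int (count_list p a) \<le> int (c + count_list p b * n)" by (simp only: of_nat_le_iff)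
    thus ?thesis by (simp add: y_def)
  qed
  show ?thesis
  proof (cases "count_list p b")
    case 0
    have "int J * int m \<le> int J * int n" using m_le by (cases "J = 0") (auto intro: mult_left_mono)
    moreover have "0 \<le> y" "y \<le> int c" using upper 0 by (simp_all add: y_def)
    ultimately have "y + int J * int m \<le> int c + int J * int n" by linarith
    thus ?thesis using 0 q \<open>0 \<le> y\<close> \<open>y \<le> int c\<close> c_le unfolding y_def[symmetric]
      by (auto simp: constraints_def lo1_def lo2_def up1_def up2_def split: if_splits)
  next
    case (Suc s)
    have s: "s \<le> J" and "c + s * n \<le> count_list p a" using st Suc by (auto simp: stair_def)
    hence "int (c + s * n) \<le> int (count_list p a)" by (simp only: of_nat_le_iff)
    hence lower: "int c + int s * int n \<le> y" by (simp add: y_def)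
    have cn: "int s * int c \<le> int s * int n" using c_le by (intro mult_left_mono) auto
    have l1: "int c * (int s + 1) \<le> y" using cn lower by (simp add: algebra_simps)
    have u1: "y \<le> int n * (int s + 1) + int c" if "J \<noteq> 0"
    proof (cases "s = J")
      case True
      thus ?thesis using ytail m_le[OF that] by (simp add: algebra_simps)
    next
      case False
      thus ?thesis using upper s Suc by (simp add: algebra_simps)
    qed
    have u2: "y + int J * int m \<le> int c + int J * int n + int m * (int s + 1)"
    proof (cases "s = J")
      case True
      thus ?thesis using ytail by (simp add: algebra_simps)
    next
      case False
      \<comment> \<open>This product is the amount by which the line of \<open>up2\<close> lies
        above that of \<open>up1\<close> at x = s + 1.\<close>
      hence "0 \<le> (int n - int m) * (int J - int s - 1)" using m_le s by (intro mult_nonneg_nonneg) auto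
      thus ?thesis using upper False s Suc by (simp add: algebra_simps)
    qed
    show ?thesis using q l1 lower u1 u2 Suc
      by (auto simp: constraints_def lo1_def lo2_def up1_def up2_def y_def algebra_simps split: if_splits)
  qed
qed

lemma admissible_generators:
  "admissible 1 0 0 stem" "admissible 1 1 0 (stem @ [b])" "admissible 1 1 1 (stem @ [b] @ replicate m a)"
proof -
  have slack: "0 \<le> slack q 1 (nb p) (na p)"
    if p: "prefix p (stem @ b # replicate m a)" and q: "q \<in> constraints" for p q
  proof (rule stair_slack[OF stair_stem[OF p] _ q])
    obtain r where "stem @ b # replicate m a = p @ r" using p unfolding prefix_def by blast
    hence "count_list (stem @ b # replicate m a) a = count_list p a + count_list r a" by simp
    thus "count_list p a \<le> c + J * n + m" by (simp add: stem_def count_list_replicate)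
  qed
  have adm: "admissible 1 e1 e2 u" if "balanced 1 e1 e2 u" "prefix u (stem @ b # replicate m a)" for e1 e2 u
    unfolding admissible_def using that slack by (auto intro: prefix_order.trans)
  show "admissible 1 0 0 stem" "admissible 1 1 0 (stem @ [b])" "admissible 1 1 1 (stem @ [b] @ replicate m a)"
    by (rule adm; simp add: balanced_def stem_def count_list_replicate)+
qed

text \<open>\<open>C\<close> is an invariant of the three counters that remembers which two of the
  three words \<open>I\<close> contains.\<close>

lemma L_eps_admissible:
  assumes "v \<in> L_eps I" and C0: "C 0 0 0"
    and I: "\<And>u N N1 N2. u \<in> I \<Longrightarrow> C N N1 N2 \<Longrightarrow>
      \<exists>e1 e2. admissible 1 e1 e2 u \<and> C (N + 1) (N1 + e1) (N2 + e2)"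
  shows "\<exists>N N1 N2. admissible N N1 N2 v \<and> C N N1 N2"
proof -
  have "(ins_step I)\<^sup>*\<^sup>* [] v" using assms(1) by (simp add: L_eps_def ins_star_def)
  thus ?thesis
  proof (induction rule: rtranclp_induct)
    case base
    have "admissible 0 0 0 []"
      by (auto simp: admissible_def balanced_def constraints_def lo1_def lo2_def up1_def up2_def split: if_splits)
    thus ?case using C0 by blast
  next
    case (step y z)
    then obtain N N1 N2 where N: "admissible N N1 N2 y" "C N N1 N2" by blast
    obtain u where u: "u \<in> I" "z \<in> shuffles y u" using step(2) by (auto simp: ins_step_def)
    obtain e1 e2 where "admissible 1 e1 e2 u" "C (N + 1) (N1 + e1) (N2 + e2)" using I[OF u(1) N(2)] by blast
    thus ?case using admissible_shuffle[OF N(1) _ u(2)] by blast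
  qed
qed

lemma admissible_region:
  assumes "admissible N N1 N2 v"
  shows "\<exists>R0 R1 R2. v = R0 @ R1 @ R2 \<and> in_region N R0 R1 R2"
proof (cases "J = 0")
  case True
  have "in_region N [] [] v" using assms True
    unfolding in_region_def within_def admissible_def constraints_def lo1_def lo2_def up1_def up2_def
    by (auto simp: c_eq)
  thus ?thesis by (metis append_Nil)
next
  case False
  have nb: "count_list v b = J * N + N1" using assms by (simp add: admissible_def balanced_def)
  have "N \<le> J * N" using False by simp
  then obtain R0 w where R0: "v = R0 @ w" "count_list R0 b = N" using split_at_count[of N v b] nb by (metis trans_le_add1)
  have "(J - 1) * N \<le> count_list w b" using nb R0 \<open>N \<le> J * N\<close> by (simp add: diff_mult_distrib)
  then obtain R1 R2 where R1: "w = R1 @ R2" "count_list R1 b = (J - 1) * N"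
    using split_at_count[of "(J - 1) * N" w b] by blast
  have *: "0 \<le> slack q (int N) (nb p) (na p)" if "prefix p v" "q \<in> {lo1, lo2, up1, up2}" for p q
  proof -
    have "q \<in> constraints" using that(2) False by (auto simp: constraints_def)
    thus ?thesis using assms that(1) unfolding admissible_def by blast
  qed
  have "in_region N R0 R1 R2"
    unfolding in_region_def within_def
  proof (intro conjI allI impI)
    show "count_list R0 b = min J 1 * N" "count_list R1 b = (J - min J 1) * N"
      using R0 R1 False by (auto simp: min_def)
  next
    fix p assume "prefix p R0"
    hence "prefix p v" using R0 by (simp add: prefix_append)
    thus "0 \<le> slack lo1 (int N) (0 + nb p) (0 + na p)" "0 \<le> slack up1 (int N) (0 + nb p) (0 + na p)"
      using * by simp_all
  next
    fix p assume "prefix p R1"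
    hence "prefix (R0 @ p) v" using R0 R1 by (simp add: prefix_append)
    thus "0 \<le> slack lo2 (int N) (nb R0 + nb p) (na R0 + na p)" "0 \<le> slack up1 (int N) (nb R0 + nb p) (na R0 + na p)"
      using *[of "R0 @ p"] by simp_all
  next
    fix p assume "prefix p R2"
    hence "prefix (R0 @ R1 @ p) v" using R0 R1 by (simp add: prefix_append)
    thus "0 \<le> slack lo2 (int N) (nb (R0 @ R1) + nb p) (na (R0 @ R1) + na p)"
      "0 \<le> slack up2 (int N) (nb (R0 @ R1) + nb p) (na (R0 @ R1) + na p)"
      using *[of "R0 @ R1 @ p"] by (simp_all add: add.assoc)
  qed
  thus ?thesis using R0 R1 by blast
qed

end

section \<open>Cutting a walk into one-sided pieces\<close>

lemma slack_shift:
  "slack q N (x + nb p) (y + na p) = slack q N x y + wt (fst q) (fst (snd q)) p"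
  by (cases q) (simp add: wt_def algebra_simps)

lemma slack_diff: "slack q (N - N') (x - x') (y - y') = slack q N x y - slack q N' x' y'"
  by (cases q) (simp add: algebra_simps)

lemma wt_rev [simp]: "wt \<alpha> \<beta> (rev w) = wt \<alpha> \<beta> w"
  by (simp add: wt_def)

lemma wt_minus: "wt (- \<alpha>) (- \<beta>) w = - wt \<alpha> \<beta> w"
  by (simp add: wt_def)

lemma wt_lower:
  assumes "\<bar>\<alpha>\<bar> \<le> L" "\<bar>\<beta>\<bar> \<le> L"
  shows "- L * int (length w) \<le> wt \<alpha> \<beta> w"
proof (induction w)
  case (Cons l w)
  thus ?case using assms by (cases l) (auto simp: algebra_simps)
qed simp

lemma within_append:
  "within lo up N x y (v @ w) \<longleftrightarrow>
    within lo up N x y v \<and> within lo up N (x + nb v) (y + na v) w"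
  by (auto simp: within_def prefix_append add.assoc)

lemma minimal_prefix:
  fixes f :: "'x list \<Rightarrow> int"
  obtains p where "prefix p w" "\<And>p'. prefix p' w \<Longrightarrow> f p \<le> f p'"
proof -
  have "finite (set (prefixes w))" "set (prefixes w) \<noteq> {}" by auto
  then obtain p where "p \<in> set (prefixes w)" "\<And>p'. p' \<in> set (prefixes w) \<Longrightarrow> f p \<le> f p'"
    using arg_min_if_finite[of "set (prefixes w)" f]
    by (metis arg_min_least)
  thus thesis using that by (auto simp: in_set_prefixes)
qed

text \<open>A piece \<open>((hi, bw), w, s)\<close> is a factor of a walk along which at most one of the two constraints,
  the active one selected by \<open>hi\<close>, can be nearly tight. The active slack is minimal at one end of the
  factor, at its right end if \<open>bw\<close> holds, and equals \<open>s\<close> there.\<close>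

type_synonym piece = "(bool \<times> bool) \<times> word \<times> nat"

abbreviation word_of :: "piece \<Rightarrow> word" where "word_of pc \<equiv> fst (snd pc)"

abbreviation words_of :: "piece list \<Rightarrow> word" where "words_of ps \<equiv> concat (map word_of ps)"

text \<open>The coefficient of \<open>a\<close> is 1 or -1, so that the active constraint yields
  exactly the walks treated above. \<open>L\<close> bounds the change of a slack per letter,
  \<open>K\<close> the size of a slack relative to N.\<close>

locale strip =
  fixes lo up :: "int \<times> int \<times> int" and L K :: int
  assumes lo_weights: "fst lo \<le> 0" "fst (snd lo) = 1"
    and up_weights: "0 \<le> fst up" "fst (snd up) = - 1"
    and weights_bound: "\<bar>fst lo\<bar> \<le> L" "\<bar>fst up\<bar> \<le> L" "1 \<le> L"
begin

definition active :: "bool \<Rightarrow> int \<times> int \<times> int" where "active hi = (if hi then up else lo)"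

text \<open>For a backward piece, reversal together with negated weights measures how far the slack
  exceeds its value at the right end.\<close>

definition walk_ok :: "bool \<times> bool \<Rightarrow> word \<Rightarrow> bool" where
  "walk_ok t w \<longleftrightarrow> (let q = active (fst t) in
     if snd t then rev w \<in> nonneg_walks (- fst q) (- fst (snd q))
     else w \<in> nonneg_walks (fst q) (fst (snd q)))"

text \<open>The other constraint keeps slack at least N/4 - L, which matters in the larger word, and
  at most K N, which matters in the smaller one. If \<open>lo = (0, 1, 0)\<close> and
  \<open>up\<close> is active, the other constraint only says y >= 0.\<close>

definition piece_ok :: "int \<Rightarrow> int \<Rightarrow> int \<Rightarrow> piece \<Rightarrow> bool" where
  "piece_ok N x y pc \<longleftrightarrow> (case pc of ((hi, bw), w, s) \<Rightarrow>
     walk_ok (hi, bw) w \<and>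
     int s = (if bw then slack (active hi) N (x + nb w) (y + na w) else slack (active hi) N x y) \<and>
     (hi \<and> lo = (0, 1, 0) \<or>
      (\<forall>p. prefix p w \<longrightarrow> N \<le> 4 * slack (active (\<not> hi)) N (x + nb p) (y + na p) + 4 * L \<and>
         slack (active (\<not> hi)) N (x + nb p) (y + na p) \<le> K * N)))"

fun pieces_ok :: "int \<Rightarrow> int \<Rightarrow> int \<Rightarrow> piece list \<Rightarrow> bool" where
  "pieces_ok N x y [] \<longleftrightarrow> True"
| "pieces_ok N x y (pc # ps) \<longleftrightarrow>
     piece_ok N x y pc \<and> pieces_ok N (x + nb (word_of pc)) (y + na (word_of pc)) ps"

definition piece_le :: "piece \<Rightarrow> piece \<Rightarrow> bool" where
  "piece_le pc pc' \<longleftrightarrow> fst pc = fst pc' \<and> snd (snd pc) \<le> snd (snd pc') \<and>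
     (\<exists>z. word_of pc' \<in> shuffles (word_of pc) z \<and> walk_ok (fst pc) z)"

text \<open>\<open>lo\<close> read forwards and \<open>up\<close> read backwards give walks in which
  \<open>a\<close> climbs; the other two tags give walks in which \<open>b\<close> climbs.\<close>

lemma almost_full_pieces: "almost_full piece_le {pc. walk_ok (fst pc) (word_of pc)}"
proof -
  have fwd: "almost_full (shuffle_le (nonneg_walks (fst (active hi)) (fst (snd (active hi)))))
      (nonneg_walks (fst (active hi)) (fst (snd (active hi))))" for hi
    using almost_full_up_walks[of "- fst lo"] almost_full_down_walks[of "fst up"] lo_weights up_weights
    by (simp add: active_def)
  have bwd: "almost_full (shuffle_le (nonneg_walks (- fst (active hi)) (- fst (snd (active hi)))))
      (nonneg_walks (- fst (active hi)) (- fst (snd (active hi))))" for hi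
    using almost_full_up_walks[of "fst up"] almost_full_down_walks[of "- fst lo"] lo_weights up_weights
    by (simp add: active_def)
  have tagged: "almost_full piece_le {pc. fst pc = (hi, bw) \<and> walk_ok (fst pc) (word_of pc)}" for hi bw
  proof -
    let ?S = "{pc :: piece. fst pc = (hi, bw) \<and> walk_ok (fst pc) (word_of pc)}"
    let ?f = "\<lambda>pc. (if bw then rev else id) (word_of pc)"
    define P where "P = (if bw then nonneg_walks (- fst (active hi)) (- fst (snd (active hi)))
      else nonneg_walks (fst (active hi)) (fst (snd (active hi))))"
    have P: "almost_full (shuffle_le P) P" using fwd bwd by (simp add: P_def)
    have "almost_full (\<lambda>pc pc'. shuffle_le P (?f pc) (?f pc')) ?S"
      by (rule almost_full_vimage[OF P]) (auto simp: P_def walk_ok_def Let_def)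
    moreover have "almost_full (\<lambda>pc pc' :: piece. snd (snd pc) \<le> snd (snd pc')) ?S"
      by (rule almost_full_vimage[OF almost_full_nat]) simp
    ultimately have "almost_full (\<lambda>pc pc'. shuffle_le P (?f pc) (?f pc') \<and> snd (snd pc) \<le> snd (snd pc')) ?S"
      by (rule almost_full_conj)
    thus ?thesis
    proof (rule almost_full_mono)
      fix pc pc' assume pc: "pc \<in> ?S" "pc' \<in> ?S"
        and le: "shuffle_le P (?f pc) (?f pc') \<and> snd (snd pc) \<le> snd (snd pc')"
      then obtain z where z: "z \<in> P" "?f pc' \<in> shuffles (?f pc) z" by (auto simp: shuffle_le_def)
      have "word_of pc' \<in> shuffles (word_of pc) (if bw then rev z else z)"
        using z(2) shuffles_rev[of "rev (word_of pc')" "rev (word_of pc)" z] by (auto split: if_splits)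
      moreover have "walk_ok (hi, bw) (if bw then rev z else z)"
        using z(1) by (auto simp: walk_ok_def P_def Let_def)
      ultimately show "piece_le pc pc'" using pc le by (auto simp: piece_le_def)
    qed simp
  qed
  have "{pc :: piece. walk_ok (fst pc) (word_of pc)} =
      ({pc. fst pc = (True, True) \<and> walk_ok (fst pc) (word_of pc)} \<union>
       {pc. fst pc = (True, False) \<and> walk_ok (fst pc) (word_of pc)}) \<union>
      ({pc. fst pc = (False, True) \<and> walk_ok (fst pc) (word_of pc)} \<union>
       {pc. fst pc = (False, False) \<and> walk_ok (fst pc) (word_of pc)})"
    by auto
  thus ?thesis using tagged by (simp only: almost_full_Un)
qed

text \<open>Active constraint: the remainder has slack s' - s at the critical end and nowhere less.
  Other constraint: at least N'/4 - L in the larger word minus at most K N in the smaller one,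
  nonnegative by the assumption on N'.\<close>

lemma piece_remainder:
  assumes ok: "piece_ok N x y pc" "piece_ok N' x' y' pc'" and le: "piece_le pc pc'"
    and big: "4 * K * N + 4 * L \<le> N'" and y: "y \<le> y'"
  shows "\<exists>z. word_of pc' \<in> shuffles (word_of pc) z \<and> within lo up (N' - N) (x' - x) (y' - y) z"
proof -
  obtain hi bw w s where pc: "pc = ((hi, bw), w, s)" by (metis prod.exhaust)
  obtain w' s' where pc': "pc' = ((hi, bw), w', s')"
    using le unfolding pc piece_le_def by (metis fst_conv prod.exhaust)
  obtain z where z: "w' \<in> shuffles w z" "walk_ok (hi, bw) z" and s: "s \<le> s'"
    using le by (auto simp: piece_le_def pc pc')
  define q where "q = active hi"
  have q_slack: "0 \<le> slack q (N' - N) (x' - x + nb p) (y' - y + na p)" if p: "prefix p z" for p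
  proof (cases bw)
    case False
    have "slack q (N' - N) (x' - x) (y' - y) = int s' - int s"
      using ok False by (simp add: slack_diff piece_ok_def pc pc' q_def)
    moreover have "0 \<le> wt (fst q) (fst (snd q)) p"
      using z(2) p False by (simp add: walk_ok_def nonneg_walks_def q_def Let_def)
    ultimately show ?thesis using s by (simp add: slack_shift)
  next
    case True
    obtain r where r: "z = p @ r" using p by (auto simp: prefix_def)
    have "prefix (rev r) (rev z)" using r by simp
    hence "0 \<le> wt (- fst q) (- fst (snd q)) (rev r)"
      using z(2) True by (simp add: walk_ok_def nonneg_walks_def q_def Let_def del: wt_rev)
    hence "wt (fst q) (fst (snd q)) r \<le> 0" by (simp add: wt_minus)
    moreover have "slack q (N' - N) (x' - x) (y' - y) + wt (fst q) (fst (snd q)) z = int s' - int s"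
    proof -
      have "int s = slack q N x y + wt (fst q) (fst (snd q)) w"
        "int s' = slack q N' x' y' + wt (fst q) (fst (snd q)) w'"
        using ok True by (simp_all add: piece_ok_def pc pc' q_def slack_shift)
      thus ?thesis using wt_shuffles[OF z(1)] by (simp add: slack_diff)
    qed
    ultimately show ?thesis using s r by (simp add: slack_shift)
  qed
  have q'_slack: "0 \<le> slack (active (\<not> hi)) (N' - N) (x' - x + nb p) (y' - y + na p)" if p: "prefix p z" for p
  proof (cases "hi \<and> lo = (0, 1, 0)")
    case True
    thus ?thesis using y unfolding active_def by auto
  next
    case False
    obtain p' p0 where p': "prefix p' w'" "prefix p0 w" "p' \<in> shuffles p0 p"
      using shuffles_prefix_right[OF z(1) p] by blast
    have c: "x' - x + nb p = (x' + nb p') - (x + nb p0)" "y' - y + na p = (y' + na p') - (y + na p0)"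
      using count_list_shuffles[OF p'(3)] by simp_all
    have "N' \<le> 4 * slack (active (\<not> hi)) N' (x' + nb p') (y' + na p') + 4 * L"
      using ok(2) False p'(1) by (auto simp: piece_ok_def pc')
    moreover have "slack (active (\<not> hi)) N (x + nb p0) (y + na p0) \<le> K * N"
      using ok(1) False p'(2) by (auto simp: piece_ok_def pc)
    ultimately show ?thesis using big unfolding c slack_diff by linarith
  qed
  have "within lo up (N' - N) (x' - x) (y' - y) z"
    unfolding within_def using q_slack q'_slack by (cases hi) (auto simp: active_def q_def)
  thus ?thesis using z(1) by (auto simp: pc pc')
qed

lemma pieces_remainder:
  assumes "pieces_ok N x y ps" "pieces_ok N' x' y' ps'" "list_all2 piece_le ps ps'"
    and "4 * K * N + 4 * L \<le> N'" "y \<le> y'" "ps \<noteq> []"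
  shows "\<exists>z. words_of ps' \<in> shuffles (words_of ps) z \<and> within lo up (N' - N) (x' - x) (y' - y) z"
  using assms
proof (induction ps arbitrary: ps' x y x' y')
  case (Cons pc ps)
  then obtain pc' qs where ps': "ps' = pc' # qs" "piece_le pc pc'" "list_all2 piece_le ps qs"
    by (auto simp: list_all2_Cons1)
  obtain z where z: "word_of pc' \<in> shuffles (word_of pc) z" "within lo up (N' - N) (x' - x) (y' - y) z"
    using piece_remainder[of N x y pc N' x' y' pc'] Cons.prems ps' by auto
  show ?case
  proof (cases "ps = []")
    case True
    thus ?thesis using z ps' by auto
  next
    case False
    have c: "x' + nb (word_of pc') - (x + nb (word_of pc)) = x' - x + nb z"
      "y' + na (word_of pc') - (y + na (word_of pc)) = y' - y + na z"
      using count_list_shuffles[OF z(1)] by simp_all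
    have "\<exists>z'. words_of qs \<in> shuffles (words_of ps) z' \<and>
        within lo up (N' - N) (x' + nb (word_of pc') - (x + nb (word_of pc)))
          (y' + na (word_of pc') - (y + na (word_of pc))) z'"
      using Cons.prems ps' False count_list_shuffles[OF z(1)] by (intro Cons.IH) auto
    then obtain z' where z': "words_of qs \<in> shuffles (words_of ps) z'"
      "within lo up (N' - N) (x' - x + nb z) (y' - y + na z) z'" unfolding c by blast
    thus ?thesis using z ps' shuffles_append[OF z(1) z'(1)]
      by (intro exI[of _ "z @ z'"]) (simp add: within_append)
  qed
qed simp

lemma pieces_ok_walks: "pieces_ok N x y ps \<Longrightarrow> set ps \<subseteq> {pc. walk_ok (fst pc) (word_of pc)}"
  by (induction ps arbitrary: x y) (auto simp: piece_ok_def)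

text \<open>Chunks of at most k letters, each cut in two where its active slack is minimal; chunks
  may be empty, which pads to exactly 2 M pieces. Unless \<open>lo\<close> is vacuous, one of the
  slacks is at least N/2 at the start of a chunk and loses at most L k <= N/4 + L along it, so N/4 -
  L remains.\<close>

lemma pieces_exist:
  assumes "within lo up N x y w" and len: "length w \<le> M * k"
    and k: "4 * L * int k \<le> N + 4 * L"
    and gap: "\<And>p. prefix p w \<Longrightarrow> lo = (0, 1, 0) \<or>
      N \<le> slack lo N (x + nb p) (y + na p) + slack up N (x + nb p) (y + na p)"
    and bound: "\<And>p. prefix p w \<Longrightarrow> slack lo N (x + nb p) (y + na p) \<le> K * N \<and>
      slack up N (x + nb p) (y + na p) \<le> K * N"
  shows "\<exists>ps. length ps = 2 * M \<and> words_of ps = w \<and> pieces_ok N x y ps"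
  using assms(1,2) gap bound
proof (induction M arbitrary: w x y)
  case 0
  thus ?case by (intro exI[of _ "[]"]) simp
next
  case (Suc M)
  define u where "u = take k w"
  define w' where "w' = drop k w"
  have w: "w = u @ w'" by (simp add: u_def w'_def)
  have wi: "within lo up N x y u" "within lo up N (x + nb u) (y + na u) w'"
    using Suc.prems(1) unfolding w within_append by auto
  have "\<exists>ps. length ps = 2 * M \<and> words_of ps = w' \<and> pieces_ok N (x + nb u) (y + na u) ps"
  proof (rule Suc.IH)
    show "length w' \<le> M * k" using Suc.prems(2) by (simp add: w'_def)
    fix p assume "prefix p w'"
    hence "prefix (u @ p) w" by (simp add: w)
    from Suc.prems(3,4)[OF this]
    show "lo = (0, 1, 0) \<or> N \<le> slack lo N (x + nb u + nb p) (y + na u + na p) +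
        slack up N (x + nb u + nb p) (y + na u + na p)"
      "slack lo N (x + nb u + nb p) (y + na u + na p) \<le> K * N \<and>
        slack up N (x + nb u + nb p) (y + na u + na p) \<le> K * N"
      by (simp_all add: add.assoc)
  qed (rule wi)
  then obtain ps where ps: "length ps = 2 * M" "words_of ps = w'" "pieces_ok N (x + nb u) (y + na u) ps"
    by blast
  \<comment> \<open>The constraint with much room is made inactive: \<open>lo\<close> if its slack
    is at least N/2 or if it is vacuous, else \<open>up\<close>, whose slack is then large by the
    gap assumption.\<close>
  define hi where "hi = (lo = (0, 1, 0) \<or> N \<le> 2 * slack lo N x y)"
  define q where "q = active hi"
  obtain p where p: "prefix p u" "\<And>p'. prefix p' u \<Longrightarrow>
      slack q N (x + nb p) (y + na p) \<le> slack q N (x + nb p') (y + na p')"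
    using minimal_prefix[of u "\<lambda>p. slack q N (x + nb p) (y + na p)"] by blast
  obtain r where r: "u = p @ r" using p(1) by (auto simp: prefix_def)
  define s where "s = nat (slack q N (x + nb p) (y + na p))"
  have s: "int s = slack q N (x + nb p) (y + na p)"
    using wi(1) p(1) by (auto simp: s_def within_def q_def active_def)
  have left: "walk_ok (hi, True) p"
    unfolding walk_ok_def nonneg_walks_def q_def[symmetric] Let_def
  proof (simp add: q_def[symmetric], intro allI impI)
    fix t assume "prefix t (rev p)"
    then obtain t' where t': "p = t' @ rev t" by (metis prefix_def rev_append rev_rev_ident)
    have "slack q N (x + nb p) (y + na p) \<le> slack q N (x + nb t') (y + na t')"
      using p(2)[of t'] r t' by simp
    hence "wt (fst q) (fst (snd q)) t \<le> 0" unfolding slack_shift t' by simp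
    thus "0 \<le> wt (- fst q) (- fst (snd q)) t" by (simp add: wt_minus)
  qed
  have right: "walk_ok (hi, False) r"
    unfolding walk_ok_def nonneg_walks_def Let_def
  proof (simp add: q_def[symmetric], intro allI impI)
    fix t assume "prefix t r"
    hence "slack q N (x + nb p) (y + na p) \<le> slack q N (x + nb (p @ t)) (y + na (p @ t))"
      using p(2)[of "p @ t"] r by simp
    thus "0 \<le> wt (fst q) (fst (snd q)) t" unfolding slack_shift by simp
  qed
  have inactive: "hi \<and> lo = (0, 1, 0) \<or>
      N \<le> 4 * slack (active (\<not> hi)) N (x + nb t) (y + na t) + 4 * L \<and>
      slack (active (\<not> hi)) N (x + nb t) (y + na t) \<le> K * N" if t: "prefix t u" for t
  proof (cases "hi \<and> lo = (0, 1, 0)")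
    case False
    define q' where "q' = active (\<not> hi)"
    have half: "N \<le> 2 * slack q' N x y"
      using False Suc.prems(3)[of "[]"] by (auto simp: q'_def active_def hi_def)
    have "- L * int (length t) \<le> wt (fst q') (fst (snd q')) t"
      using wt_lower[of "fst q'" L "fst (snd q')" t] weights_bound lo_weights up_weights
      by (auto simp: q'_def active_def)
    moreover have "L * int (length t) \<le> L * int k"
      using t weights_bound prefix_length_le[OF t] by (intro mult_left_mono) (auto simp: u_def)
    ultimately have "slack q' N x y - L * int k \<le> slack q' N (x + nb t) (y + na t)"
      unfolding slack_shift by linarith
    hence "N \<le> 4 * slack q' N (x + nb t) (y + na t) + 4 * L" using half k by linarith
    moreover have "prefix t w" using t by (simp add: w prefix_append)
    hence "slack q' N (x + nb t) (y + na t) \<le> K * N"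
      using Suc.prems(4)[of t] by (auto simp: q'_def active_def)
    ultimately show ?thesis by (simp add: q'_def)
  qed simp
  have "piece_ok N x y ((hi, True), p, s)"
    using left s inactive r by (auto simp: piece_ok_def q_def)
  moreover have "piece_ok N (x + nb p) (y + na p) ((hi, False), r, s)"
    unfolding piece_ok_def using right s inactive[of "p @ _"] r by (auto simp: q_def add.assoc)
  moreover have "nb u = nb p + nb r" "na u = na p + na r" by (simp_all add: r)
  ultimately show ?case using ps r w
    by (intro exI[of _ "((hi, True), p, s) # ((hi, False), r, s) # ps"]) (simp add: add.assoc)
qed

end

section \<open>Comparing words piece by piece\<close>

lemma finite_bounded_words: "finite {w :: word. length w \<le> k}"
proof -
  have "(UNIV :: letter set) = {a, b}" using letter.exhaust by auto
  hence "finite (UNIV :: letter set)" by (metis finite.emptyI finite.insertI)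
  from finite_lists_length_le[OF this, of k] show ?thesis by simp
qed

text \<open>Either some later element is large compared with the first one, or all later words have
  bounded length and one of them repeats.\<close>

lemma almost_full_small_or_big:
  fixes g :: "'e \<Rightarrow> word" and h :: "'e \<Rightarrow> nat"
  assumes "\<And>e. e \<in> S \<Longrightarrow> length (g e) \<le> D * h e"
  shows "almost_full (\<lambda>e e'. g e = g e' \<or> k * h e + l \<le> h e') S"
proof (rule almost_fullI)
  fix f :: "nat \<Rightarrow> 'e" assume f: "\<And>i. f i \<in> S"
  show "\<exists>i j. i < j \<and> (g (f i) = g (f j) \<or> k * h (f i) + l \<le> h (f j))"
  proof (cases "\<exists>j>0. k * h (f 0) + l \<le> h (f j)")
    case False
    define T where "T = k * h (f 0) + l"
    have "length (g (f (Suc j))) \<le> D * T" for j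
    proof -
      have "h (f (Suc j)) \<le> T" using False T_def by (meson nat_le_linear zero_less_Suc)
      hence "D * h (f (Suc j)) \<le> D * T" by simp
      thus ?thesis using assms[OF f[of "Suc j"]] by linarith
    qed
    hence "\<And>j. g (f (Suc j)) \<in> {w. length w \<le> D * T}" by simp
    then obtain i j where "i < j" "g (f (Suc i)) = g (f (Suc j))"
      using almost_fullD[OF almost_full_eq_finite[OF finite_bounded_words], of "\<lambda>j. g (f (Suc j))" "D * T"] by blast
    thus ?thesis by (intro exI[of _ "Suc i"] exI[of _ "Suc j"]) simp
  qed auto
qed

section \<open>Words together with their counters and pieces\<close>

type_synonym config = "nat \<times> nat \<times> nat \<times> piece list \<times> piece list \<times> piece list"

fun word_of_config :: "config \<Rightarrow> word" where
  "word_of_config (N, N1, N2, A, B, C) = words_of A @ words_of B @ words_of C"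

context staircase
begin

text \<open>\<open>wmax\<close> bounds the coefficients of x and y, and \<open>lmax\<close> the
  length of a word divided by N. The three summands of \<open>smax\<close> bound \<alpha> x, \<beta>
  y and \<gamma> N divided by N, given x <= (J + 1) N and y <= (c + J n + m) N. A chunk will have
  size above N / (4 wmax), so \<open>chunks\<close> of them cover a word.\<close>

definition wmax :: nat where "wmax = n + m + 1"
definition smax :: nat where "smax = (n + m) * (J + 1) + (c + J * n + m) + (n + c + J * n)"
definition lmax :: nat where "lmax = (J + 1) + (c + J * n + m)"
definition chunks :: nat where "chunks = lmax * (4 * wmax)"

sublocale r0: strip lo1 up1 "int wmax" "int smax"
  by unfold_locales (use c_le in \<open>auto simp: lo1_def up1_def wmax_def\<close>)

sublocale r1: strip lo2 up1 "int wmax" "int smax"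
  by unfold_locales (auto simp: lo2_def up1_def wmax_def)

sublocale r2: strip lo2 up2 "int wmax" "int smax"
  by unfold_locales (auto simp: lo2_def up2_def wmax_def)

fun valid :: "config \<Rightarrow> bool" where
  "valid (N, N1, N2, A, B, C) \<longleftrightarrow>
     balanced N N1 N2 (words_of A @ words_of B @ words_of C) \<and>
     count_list (words_of A) b = min J 1 * N \<and> count_list (words_of B) b = (J - min J 1) * N \<and>
     length A = 2 * chunks \<and> length B = 2 * chunks \<and> length C = 2 * chunks \<and>
     r0.pieces_ok (int N) 0 0 A \<and>
     r1.pieces_ok (int N) (nb (words_of A)) (na (words_of A)) B \<and>
     r2.pieces_ok (int N) (nb (words_of A @ words_of B)) (na (words_of A @ words_of B)) C"

lemma balanced_length:
  assumes "balanced N N1 N2 v"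
  shows "length v \<le> lmax * N" "nb v \<le> int (J + 1) * int N" "na v \<le> int (c + J * n + m) * int N"
proof -
  have N: "N1 \<le> N" "m * N2 \<le> m * N" using assms by (auto simp: balanced_def)
  have b: "count_list v b \<le> (J + 1) * N" and y: "count_list v a \<le> (c + J * n + m) * N"
    using assms N by (auto simp: balanced_def algebra_simps)
  show "length v \<le> lmax * N"
    using b y count_ab[of v] by (simp add: lmax_def algebra_simps)
  show "nb v \<le> int (J + 1) * int N" using b by (metis of_nat_le_iff of_nat_mult)
  show "na v \<le> int (c + J * n + m) * int N" using y by (metis of_nat_le_iff of_nat_mult)
qed

lemma slack_le:
  assumes "q \<in> {lo1, lo2, up1, up2}" "0 \<le> x" "x \<le> int (J + 1) * int N" "0 \<le> y" "y \<le> int (c + J * n + m) * int N"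
  shows "slack q (int N) x y \<le> int smax * int N"
proof -
  obtain \<alpha> \<beta> \<gamma> where q: "q = (\<alpha>, \<beta>, \<gamma>)" by (metis prod.exhaust)
  have "0 \<le> int J * int m" by simp
  hence "int c + int J * int n - int J * int m \<le> int (n + c + J * n)" by (simp only: of_nat_add of_nat_mult)
  hence *: "\<alpha> \<le> int (n + m)" "\<beta> \<le> 1" "\<gamma> \<le> int (n + c + J * n)"
    using assms(1) by (auto simp: q lo1_def lo2_def up1_def up2_def)
  have "\<alpha> * x \<le> int (n + m) * x" using * assms(2) by (intro mult_right_mono)
  also have "\<dots> \<le> int (n + m) * (int (J + 1) * int N)" using assms(3) by (intro mult_left_mono) auto
  finally have 1: "\<alpha> * x \<le> int ((n + m) * (J + 1)) * int N" by (simp add: algebra_simps)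
  have "\<beta> * y \<le> 1 * y" using * assms(4) by (intro mult_right_mono)
  hence 2: "\<beta> * y \<le> int (c + J * n + m) * int N" using assms(5) by linarith
  have 3: "\<gamma> * int N \<le> int (n + c + J * n) * int N" using * by (intro mult_right_mono) auto
  have "int smax * int N = int ((n + m) * (J + 1)) * int N + int (c + J * n + m) * int N +
      int (n + c + J * n) * int N"
    unfolding smax_def of_nat_add[of "_ + _" "n + c + J * n"] of_nat_add[of "_ * _" "c + J * n + m"]
    by (simp only: distrib_right)
  thus ?thesis using 1 2 3 unfolding q slack.simps by linarith
qed

lemma config_exists:
  assumes adm: "admissible N N1 N2 v"
  shows "\<exists>A B C. valid (N, N1, N2, A, B, C) \<and> word_of_config (N, N1, N2, A, B, C) = v"
proof -
  obtain R0 R1 R2 where v: "v = R0 @ R1 @ R2" and R: "in_region N R0 R1 R2"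
    using admissible_region[OF adm] by blast
  have bal: "balanced N N1 N2 v" using adm by (simp add: admissible_def)
  have N1: "N1 \<le> N" and nbv: "count_list v b = J * N + N1" using bal by (auto simp: balanced_def)
  \<comment> \<open>Rounding up makes the chunks cover the word; the extra 1 costs up to 4 L in the
    condition on k, the additive term carried along since \<open>piece_ok\<close>.\<close>
  define k where "k = N div (4 * wmax) + 1"
  have wmax: "0 < wmax" by (simp add: wmax_def)
  have k: "4 * int wmax * int k \<le> int N + 4 * int wmax"
  proof -
    have "4 * wmax * (N div (4 * wmax)) \<le> N" by simp
    hence "4 * wmax * k \<le> N + 4 * wmax" by (simp add: k_def algebra_simps)
    hence "int (4 * wmax * k) \<le> int (N + 4 * wmax)" by (simp only: of_nat_le_iff)
    thus ?thesis by simp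
  qed
  have "N \<le> 4 * wmax * k"
    using wmax dividend_less_div_times[of "4 * wmax" N] by (simp add: k_def algebra_simps)
  hence "lmax * N \<le> lmax * (4 * wmax * k)" by (rule mult_le_mono2)
  also have "\<dots> = chunks * k" by (simp only: chunks_def mult.assoc)
  finally have len: "length u \<le> chunks * k" if "length u \<le> length v" for u :: word
    using that balanced_length(1)[OF bal] by linarith
  have bound: "slack q (int N) (nb p) (na p) \<le> int smax * int N"
    if p: "prefix p v" and q: "q \<in> {lo1, lo2, up1, up2}" for p q
  proof (rule slack_le[OF q])
    have "nb p \<le> nb v" "na p \<le> na v" using p by (auto simp: prefix_def)
    thus "nb p \<le> int (J + 1) * int N" "na p \<le> int (c + J * n + m) * int N"
      using balanced_length(2,3)[OF bal] by linarith+
  qed simp_all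
  have n1: "1 * int N \<le> int n * int N" using n_pos by (intro mult_right_mono) auto
  have "\<exists>ps. length ps = 2 * chunks \<and> words_of ps = R0 \<and> r0.pieces_ok (int N) 0 0 ps"
  proof (rule r0.pieces_exist[OF _ len k])
    show "within lo1 up1 (int N) 0 0 R0" using R by (simp add: in_region_def)
    fix p assume p: "prefix p R0"
    show "slack lo1 (int N) (0 + nb p) (0 + na p) \<le> int smax * int N \<and>
        slack up1 (int N) (0 + nb p) (0 + na p) \<le> int smax * int N"
      using bound[of p] p v by (simp add: prefix_append)
    show "lo1 = (0, 1, 0) \<or> int N \<le> slack lo1 (int N) (0 + nb p) (0 + na p) + slack up1 (int N) (0 + nb p) (0 + na p)"
    proof (cases "c = 0")
      case True
      thus ?thesis unfolding lo1_def by simp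
    next
      case False
      have "1 * int N \<le> int c * int N" using False by (intro mult_right_mono) auto
      moreover have "0 \<le> (int n - int c) * nb p" using c_le by simp
      ultimately show ?thesis by (simp add: lo1_def up1_def algebra_simps)
    qed
  qed (simp add: v)
  then obtain A where A: "length A = 2 * chunks" "words_of A = R0" "r0.pieces_ok (int N) 0 0 A" by blast
  have "\<exists>ps. length ps = 2 * chunks \<and> words_of ps = R1 \<and> r1.pieces_ok (int N) (nb R0) (na R0) ps"
  proof (rule r1.pieces_exist[OF _ len k])
    show "within lo2 up1 (int N) (nb R0) (na R0) R1" using R unfolding in_region_def by blast
    fix p assume p: "prefix p R1"
    show "slack lo2 (int N) (nb R0 + nb p) (na R0 + na p) \<le> int smax * int N \<and>
        slack up1 (int N) (nb R0 + nb p) (na R0 + na p) \<le> int smax * int N"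
      using bound[of "R0 @ p"] p v by (simp add: prefix_append)
    show "lo2 = (0, 1, 0) \<or> int N \<le> slack lo2 (int N) (nb R0 + nb p) (na R0 + na p) + slack up1 (int N) (nb R0 + nb p) (na R0 + na p)"
      using n1 by (simp add: lo2_def up1_def algebra_simps)
  qed (simp add: v)
  then obtain B where B: "length B = 2 * chunks" "words_of B = R1" "r1.pieces_ok (int N) (nb R0) (na R0) B" by blast
  have "\<exists>ps. length ps = 2 * chunks \<and> words_of ps = R2 \<and>
      r2.pieces_ok (int N) (nb (R0 @ R1)) (na (R0 @ R1)) ps"
  proof (rule r2.pieces_exist[OF _ len k])
    show "within lo2 up2 (int N) (nb (R0 @ R1)) (na (R0 @ R1)) R2" using R unfolding in_region_def by blast
    fix p assume p: "prefix p R2"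
    define x where "x = nb (R0 @ R1) + nb p"
    define y where "y = na (R0 @ R1) + na p"
    have pre: "prefix (R0 @ R1 @ p) v" using p v by (simp add: prefix_append)
    have xy: "x = nb (R0 @ R1 @ p)" "y = na (R0 @ R1 @ p)" by (simp_all add: x_def y_def)
    show "slack lo2 (int N) x y \<le> int smax * int N \<and> slack up2 (int N) x y \<le> int smax * int N"
      unfolding xy using bound[OF pre] by blast
    have "count_list R0 b + count_list R1 b = (min J 1 + (J - min J 1)) * N"
      using R unfolding in_region_def add_mult_distrib by simp
    hence "nb (R0 @ R1) = int (J * N)" by simp
    moreover have "nb (R0 @ R1 @ p) \<le> nb v" using pre by (auto simp: prefix_def)
    hence "x \<le> int (J * N + N1)" unfolding xy nbv[symmetric] .
    ultimately have x: "0 \<le> x - int J * int N" "x - int J * int N \<le> int N"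
      using N1 by (auto simp: x_def)
    \<comment> \<open>The right side is the sum of the slacks of \<open>lo2\<close> and
      \<open>up2\<close>. As x - J N lies between 0 and N, it is at least m N or n N.\<close>
    have "int N \<le> int n * int N - (int n - int m) * (x - int J * int N)"
    proof (cases "m \<le> n")
      case True
      hence "(int n - int m) * (x - int J * int N) \<le> (int n - int m) * int N"
        using x by (intro mult_left_mono) auto
      moreover have "1 * int N \<le> int m * int N" using m_pos by (intro mult_right_mono) auto
      ultimately show ?thesis by (simp add: algebra_simps)
    next
      case False
      hence "(int n - int m) * (x - int J * int N) \<le> 0"
        using x(1) by (intro mult_nonpos_nonneg) auto
      thus ?thesis using n1 by linarith
    qed
    thus "lo2 = (0, 1, 0) \<or> int N \<le> slack lo2 (int N) x y + slack up2 (int N) x y"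
      by (simp add: lo2_def up2_def algebra_simps)
  qed (simp add: v)
  then obtain C where C: "length C = 2 * chunks" "words_of C = R2"
    "r2.pieces_ok (int N) (nb (R0 @ R1)) (na (R0 @ R1)) C" by blast
  have "valid (N, N1, N2, A, B, C)"
    unfolding valid.simps A(2) B(2) C(2) v[symmetric]
    using A(1,3) B(1,3) C(1,3) R bal unfolding in_region_def by blast
  thus ?thesis using A B C v by (intro exI[of _ A] exI[of _ B] exI[of _ C]) simp
qed

text \<open>N - N1, N1 - N2 and N2 count the copies without final \<open>b\<close>, those ending in
  it, and those with a tail. All three have to grow for the remainder to be \<open>balanced\<close>;
  under \<open>balanced\<close> the truncated subtractions are exact.\<close>

fun config_le :: "config \<Rightarrow> config \<Rightarrow> bool" where
  "config_le (N, N1, N2, A, B, C) (N', N1', N2', A', B', C') \<longleftrightarrow>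
     4 * smax * N + 4 * wmax \<le> N' \<and> N - N1 \<le> N' - N1' \<and> N1 - N2 \<le> N1' - N2' \<and> N2 \<le> N2' \<and>
     list_all2 r0.piece_le A A' \<and> list_all2 r1.piece_le B B' \<and> list_all2 r2.piece_le C C'"

lemma config_remainder:
  assumes valid: "valid (N, N1, N2, A, B, C)" "valid (N', N1', N2', A', B', C')"
    and le: "config_le (N, N1, N2, A, B, C) (N', N1', N2', A', B', C')"
  shows "\<exists>Z0 Z1 Z2. word_of_config (N', N1', N2', A', B', C') \<in>
      shuffles (word_of_config (N, N1, N2, A, B, C)) (Z0 @ Z1 @ Z2) \<and>
    in_region (N' - N) Z0 Z1 Z2 \<and> balanced (N' - N) (N1' - N1) (N2' - N2) (Z0 @ Z1 @ Z2)"
proof -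
  have bal: "balanced N N1 N2 (words_of A @ words_of B @ words_of C)"
    "balanced N' N1' N2' (words_of A' @ words_of B' @ words_of C')"
    using valid by simp_all
  hence N: "N2 \<le> N1" "N1 \<le> N" "N2' \<le> N1'" "N1' \<le> N'" by (auto simp: balanced_def)
  hence NN: "N \<le> N'" "N1 \<le> N1'" "N2 \<le> N2'" "N2' - N2 \<le> N1' - N1" "N1' - N1 \<le> N' - N"
    using le by auto
  have iN: "int (N' - N) = int N' - int N" using NN by simp
  have big: "4 * int smax * int N + 4 * int wmax \<le> int N'"
  proof -
    have "int (4 * smax * N + 4 * wmax) \<le> int N'" using le by (simp only: config_le.simps of_nat_le_iff)
    thus ?thesis by simp
  qed
  have ne: "A \<noteq> []" "B \<noteq> []" "C \<noteq> []" using valid by (auto simp: chunks_def lmax_def wmax_def)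
  have ok: "r0.pieces_ok (int N) 0 0 A" "r0.pieces_ok (int N') 0 0 A'"
    "r1.pieces_ok (int N) (nb (words_of A)) (na (words_of A)) B"
    "r1.pieces_ok (int N') (nb (words_of A')) (na (words_of A')) B'"
    "r2.pieces_ok (int N) (nb (words_of A @ words_of B)) (na (words_of A @ words_of B)) C"
    "r2.pieces_ok (int N') (nb (words_of A' @ words_of B')) (na (words_of A' @ words_of B')) C'"
    using valid unfolding valid.simps by blast+
  have les: "list_all2 r0.piece_le A A'" "list_all2 r1.piece_le B B'" "list_all2 r2.piece_le C C'"
    using le unfolding config_le.simps by blast+
  have "\<exists>z. words_of A' \<in> shuffles (words_of A) z \<and> within lo1 up1 (int N' - int N) (0 - 0) (0 - 0) z"
    by (rule r0.pieces_remainder[OF ok(1,2) les(1) big _ ne(1)]) simp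
  then obtain Z0 where Z0: "words_of A' \<in> shuffles (words_of A) Z0" "within lo1 up1 (int (N' - N)) 0 0 Z0"
    by (auto simp: iN)
  have c0: "nb (words_of A') - nb (words_of A) = nb Z0" "na (words_of A') - na (words_of A) = na Z0"
    using count_list_shuffles[OF Z0(1)] by simp_all
  have "\<exists>z. words_of B' \<in> shuffles (words_of B) z \<and> within lo2 up1 (int N' - int N)
      (nb (words_of A') - nb (words_of A)) (na (words_of A') - na (words_of A)) z"
    by (rule r1.pieces_remainder[OF ok(3,4) les(2) big _ ne(2)]) (use c0(2) in linarith)
  then obtain Z1 where Z1: "words_of B' \<in> shuffles (words_of B) Z1"
    "within lo2 up1 (int (N' - N)) (nb Z0) (na Z0) Z1"
    unfolding iN c0 by blast
  have AB: "words_of A' @ words_of B' \<in> shuffles (words_of A @ words_of B) (Z0 @ Z1)"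
    by (rule shuffles_append[OF Z0(1) Z1(1)])
  have c1: "nb (words_of A' @ words_of B') - nb (words_of A @ words_of B) = nb (Z0 @ Z1)"
    "na (words_of A' @ words_of B') - na (words_of A @ words_of B) = na (Z0 @ Z1)"
    using count_list_shuffles[OF AB, of a] count_list_shuffles[OF AB, of b] by simp_all
  have "\<exists>z. words_of C' \<in> shuffles (words_of C) z \<and> within lo2 up2 (int N' - int N)
      (nb (words_of A' @ words_of B') - nb (words_of A @ words_of B))
      (na (words_of A' @ words_of B') - na (words_of A @ words_of B)) z"
    by (rule r2.pieces_remainder[OF ok(5,6) les(3) big _ ne(3)]) (use c1(2) in linarith)
  then obtain Z2 where Z2: "words_of C' \<in> shuffles (words_of C) Z2"
    "within lo2 up2 (int (N' - N)) (nb (Z0 @ Z1)) (na (Z0 @ Z1)) Z2"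
    unfolding iN c1 by blast
  have sh: "words_of A' @ words_of B' @ words_of C' \<in>
      shuffles (words_of A @ words_of B @ words_of C) (Z0 @ Z1 @ Z2)"
    using shuffles_append[OF AB Z2(1)] by simp
  have counts: "count_list (words_of A) b = min J 1 * N" "count_list (words_of A') b = min J 1 * N'"
    "count_list (words_of B) b = (J - min J 1) * N" "count_list (words_of B') b = (J - min J 1) * N'"
    using valid unfolding valid.simps by blast+
  have "count_list Z0 b = min J 1 * (N' - N)"
    using count_list_shuffles[OF Z0(1), of b] unfolding counts diff_mult_distrib2 by linarith
  moreover have "count_list Z1 b = (J - min J 1) * (N' - N)"
    using count_list_shuffles[OF Z1(1), of b] unfolding counts diff_mult_distrib2 by linarith
  ultimately have "in_region (N' - N) Z0 Z1 Z2"
    unfolding in_region_def using Z0(2) Z1(2) Z2(2) by blast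
  moreover have "balanced (N' - N) (N1' - N1) (N2' - N2) (Z0 @ Z1 @ Z2)"
  proof -
    let ?z = "Z0 @ Z1 @ Z2"
    have "count_list ?z b = (J * N' + N1') - (J * N + N1)"
      "count_list ?z a = ((c + J * n) * N' + m * N2') - ((c + J * n) * N + m * N2)"
      using count_list_shuffles[OF sh, of b] count_list_shuffles[OF sh, of a] bal
      unfolding balanced_def by linarith+
    moreover have "J * N \<le> J * N'" "(c + J * n) * N \<le> (c + J * n) * N'" "m * N2 \<le> m * N2'"
      using NN by simp_all
    ultimately have "count_list ?z b = J * N' - J * N + (N1' - N1)"
      "count_list ?z a = (c + J * n) * N' - (c + J * n) * N + (m * N2' - m * N2)"
      using NN by linarith+
    thus ?thesis using NN(4,5) unfolding balanced_def diff_mult_distrib2 by blast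
  qed
  ultimately show ?thesis using sh by (intro exI[of _ Z0] exI[of _ Z1] exI[of _ Z2]) simp
qed

lemma valid_pieces:
  assumes "valid e"
  shows "(\<lambda>(N, N1, N2, A, B, C). A) e \<in> {ps. length ps = 2 * chunks \<and> set ps \<subseteq> {pc. r0.walk_ok (fst pc) (word_of pc)}}"
    "(\<lambda>(N, N1, N2, A, B, C). B) e \<in> {ps. length ps = 2 * chunks \<and> set ps \<subseteq> {pc. r1.walk_ok (fst pc) (word_of pc)}}"
    "(\<lambda>(N, N1, N2, A, B, C). C) e \<in> {ps. length ps = 2 * chunks \<and> set ps \<subseteq> {pc. r2.walk_ok (fst pc) (word_of pc)}}"
proof -
  obtain N N1 N2 A B C where e: "e = (N, N1, N2, A, B, C)" by (metis prod.exhaust)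
  show "(\<lambda>(N, N1, N2, A, B, C). A) e \<in> {ps. length ps = 2 * chunks \<and> set ps \<subseteq> {pc. r0.walk_ok (fst pc) (word_of pc)}}"
    "(\<lambda>(N, N1, N2, A, B, C). B) e \<in> {ps. length ps = 2 * chunks \<and> set ps \<subseteq> {pc. r1.walk_ok (fst pc) (word_of pc)}}"
    "(\<lambda>(N, N1, N2, A, B, C). C) e \<in> {ps. length ps = 2 * chunks \<and> set ps \<subseteq> {pc. r2.walk_ok (fst pc) (word_of pc)}}"
    using assms r0.pieces_ok_walks r1.pieces_ok_walks r2.pieces_ok_walks
    unfolding e valid.simps prod.case mem_Collect_eq by blast+
qed

lemma almost_full_configs:
  "almost_full (\<lambda>e e'. word_of_config e = word_of_config e' \<or> config_le e e') {e. valid e}"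
proof -
  let ?S = "{e. valid e}"
  have big: "almost_full (\<lambda>e e'. word_of_config e = word_of_config e' \<or> 4 * smax * fst e + 4 * wmax \<le> fst e') ?S"
  proof (rule almost_full_small_or_big[where D = lmax])
    fix e assume e: "e \<in> ?S"
    obtain N N1 N2 A B C where "e = (N, N1, N2, A, B, C)" by (metis prod.exhaust)
    thus "length (word_of_config e) \<le> lmax * fst e"
      using e balanced_length(1)[of N N1 N2 "words_of A @ words_of B @ words_of C"] by simp
  qed
  have nat: "almost_full (\<lambda>e e'. g e \<le> g e') ?S" for g :: "config \<Rightarrow> nat"
    by (rule almost_full_vimage[OF almost_full_nat]) simp
  have A: "almost_full (\<lambda>e e'. list_all2 r0.piece_le ((\<lambda>(N, N1, N2, A, B, C). A) e) ((\<lambda>(N, N1, N2, A, B, C). A) e')) ?S"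
    by (rule almost_full_vimage[OF almost_full_lists[OF r0.almost_full_pieces]], rule valid_pieces) simp
  have B: "almost_full (\<lambda>e e'. list_all2 r1.piece_le ((\<lambda>(N, N1, N2, A, B, C). B) e) ((\<lambda>(N, N1, N2, A, B, C). B) e')) ?S"
    by (rule almost_full_vimage[OF almost_full_lists[OF r1.almost_full_pieces]], rule valid_pieces) simp
  have C: "almost_full (\<lambda>e e'. list_all2 r2.piece_le ((\<lambda>(N, N1, N2, A, B, C). C) e) ((\<lambda>(N, N1, N2, A, B, C). C) e')) ?S"
    by (rule almost_full_vimage[OF almost_full_lists[OF r2.almost_full_pieces]], rule valid_pieces) simp
  note all = almost_full_conj[OF big almost_full_conj[OF nat[of "\<lambda>(N, N1, N2, _). N - N1"]
    almost_full_conj[OF nat[of "\<lambda>(N, N1, N2, _). N1 - N2"] almost_full_conj[OF nat[of "\<lambda>(N, N1, N2, _). N2"]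
    almost_full_conj[OF A almost_full_conj[OF B C]]]]]]
  show ?thesis by (rule almost_full_mono[OF all]) auto
qed

text \<open>\<open>P\<close> describes the counters reachable with \<open>I\<close>: N2 = 0 for the
  first pair of words, N1 = N for the second. Differences of such counters use only copies from
  \<open>I\<close> again, so the remainder is derivable.\<close>

lemma wqo_on_ins_star:
  assumes covered: "\<And>v. v \<in> L_eps I \<Longrightarrow> \<exists>N N1 N2. admissible N N1 N2 v \<and> P N N1 N2"
    and copies: "\<And>N N1 N2 N' N1' N2' r. P N N1 N2 \<Longrightarrow> P N' N1' N2' \<Longrightarrow> r < N' - N \<Longrightarrow>
      copy_of (N1' - N1) (N2' - N2) r \<in> I"
  shows "wqo_on (ins_star I) (L_eps I)"
  unfolding wqo_on_def
proof (intro conjI allI impI)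
  fix f :: "nat \<Rightarrow> word" assume f: "\<forall>i. f i \<in> L_eps I"
  have "\<exists>e. valid e \<and> word_of_config e = f i \<and> (case e of (N, N1, N2, _) \<Rightarrow> P N N1 N2)" for i
  proof -
    obtain N N1 N2 where N: "admissible N N1 N2 (f i)" "P N N1 N2" using covered f by blast
    obtain A B C where "valid (N, N1, N2, A, B, C)" "word_of_config (N, N1, N2, A, B, C) = f i"
      using config_exists[OF N(1)] by blast
    thus ?thesis using N(2) by (intro exI[of _ "(N, N1, N2, A, B, C)"]) (simp del: valid.simps word_of_config.simps)
  qed
  then obtain e where e: "\<And>i. valid (e i)" "\<And>i. word_of_config (e i) = f i"
    "\<And>i. case e i of (N, N1, N2, _) \<Rightarrow> P N N1 N2" by metis
  obtain i j where ij: "i < j" "word_of_config (e i) = word_of_config (e j) \<or> config_le (e i) (e j)"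
    using almost_fullD[OF almost_full_configs, of e] e(1) by auto
  have "ins_star I (f i) (f j)"
  proof (cases "f i = f j")
    case True
    thus ?thesis by (simp add: ins_star_def)
  next
    case False
    hence le: "config_le (e i) (e j)" using ij(2) e(2) by simp
    obtain N N1 N2 A B C where ei: "e i = (N, N1, N2, A, B, C)" by (metis prod.exhaust)
    obtain N' N1' N2' A' B' C' where ej: "e j = (N', N1', N2', A', B', C')" by (metis prod.exhaust)
    obtain Z0 Z1 Z2 where Z: "f j \<in> shuffles (f i) (Z0 @ Z1 @ Z2)" "in_region (N' - N) Z0 Z1 Z2"
      "balanced (N' - N) (N1' - N1) (N2' - N2) (Z0 @ Z1 @ Z2)"
      using config_remainder[of N N1 N2 A B C N' N1' N2' A' B' C'] le e(1)[of i] e(1)[of j] e(2)[of i] e(2)[of j]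
      unfolding ei ej by metis
    have "Z0 @ Z1 @ Z2 \<in> L_eps I"
      using balanced_region_in_L_eps[OF Z(3) refl Z(2)] copies e(3)[of i] e(3)[of j] by (simp add: ei ej)
    thus ?thesis using ins_star_shuffle Z(1) by blast
  qed
  thus "\<exists>i j. i < j \<and> ins_star I (f i) (f j)" using ij(1) by blast
qed (auto simp: ins_star_def)

theorem wqo_stem:
  "wqo_on (ins_star {stem, stem @ [b]}) (L_eps {stem, stem @ [b]})"
  "wqo_on (ins_star {stem @ [b], stem @ [b] @ replicate m a}) (L_eps {stem @ [b], stem @ [b] @ replicate m a})"
proof -
  let ?I = "{stem, stem @ [b]}"
  show "wqo_on (ins_star ?I) (L_eps ?I)"
  proof (rule wqo_on_ins_star)
    show "\<exists>N N1 N2. admissible N N1 N2 v \<and> N2 = 0" if "v \<in> L_eps ?I" for v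
    proof (rule L_eps_admissible[OF that])
      fix u N N1 and N2 :: nat assume "u \<in> ?I" "N2 = 0"
      thus "\<exists>e1 e2. admissible 1 e1 e2 u \<and> N2 + e2 = 0" using admissible_generators(1,2) by auto
    qed simp
  qed (auto simp: copy_of_def)
  let ?I = "{stem @ [b], stem @ [b] @ replicate m a}"
  show "wqo_on (ins_star ?I) (L_eps ?I)"
  proof (rule wqo_on_ins_star)
    show "\<exists>N N1 N2. admissible N N1 N2 v \<and> N1 = N" if "v \<in> L_eps ?I" for v
    proof (rule L_eps_admissible[OF that])
      fix u and N N1 N2 :: nat assume "u \<in> ?I" "N1 = N"
      thus "\<exists>e1 e2. admissible 1 e1 e2 u \<and> N1 + e1 = N + 1" using admissible_generators(2,3) by auto
    qed simp
  qed (auto simp: copy_of_def)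
qed

end

theorem theorem5:
  fixes n m :: nat and w :: word
  assumes "n \<ge> 1" and "m \<ge> 1" and "w \<in> Wlang n"
    and "good (w @ replicate n a @ [b] @ replicate m a)"
  shows "wqo_on (ins_star {w @ replicate n a, w @ replicate n a @ [b]})
                (L_eps {w @ replicate n a, w @ replicate n a @ [b]}) \<and>
         wqo_on (ins_star {w @ replicate n a @ [b], w @ replicate n a @ [b] @ replicate m a})
                (L_eps {w @ replicate n a @ [b], w @ replicate n a @ [b] @ replicate m a})"
proof -
  obtain c J where s: "staircase c n J m" and stem: "w @ replicate n a = staircase.stem c n J"
  proof (cases "w = []")
    case True
    have "staircase n n 0 m" using assms by unfold_locales auto
    thus thesis using that[of n 0] True by (simp add: staircase.stem_def)
  next
    case False
    then obtain i j where w: "i \<le> n" "w = replicate i a @ concat (replicate j (b # replicate n a)) @ [b]"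
      using assms(3) by (auto simp: Wlang_def)
    \<comment> \<open>The reversed word starts with a^m b a^n b, which for m > n is a bad factor
      with k = m, l = n and m' = 1.\<close>
    have "m \<le> n"
    proof (rule ccontr)
      assume "\<not> m \<le> n"
      let ?x = "w @ replicate n a @ [b] @ replicate m a"
      have "rev ?x = (replicate m a @ [b] @ replicate n a @ replicate 1 b) @
          rev (replicate i a @ concat (replicate j (b # replicate n a)))"
        by (simp add: w(2))
      hence "sublist (replicate m a @ [b] @ replicate n a @ replicate 1 b) (rev ?x)"
        by (metis prefix_imp_sublist prefixI)
      hence "has_bad_factor (rev ?x)"
        unfolding has_bad_factor_def using \<open>\<not> m \<le> n\<close> assms(1) by (metis le_refl not_le)
      thus False using assms(4) by (simp add: good_def bad_def)
    qed
    hence "staircase i n (Suc j) m" using assms w(1) by unfold_locales auto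
    moreover from this have "w @ replicate n a = staircase.stem i n (Suc j)"
      by (simp add: staircase.stem_def w(2) flip: replicate_append_same)
    ultimately show thesis using that by blast
  qed
  have eq: "w @ replicate n a @ u = staircase.stem c n J @ u" for u
    using stem by (metis append.assoc)
  show ?thesis unfolding eq stem using staircase.wqo_stem[OF s] by blast
qed

end
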